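(* Let $A\subset\mathbb R^d$ be a point configuration labelled by $[n]$ and let $[X_1,Y_1]$, $[X_2,Y_2]$ be tiles. The following are equivalent: (1) the tiles are separated; (2) there is a zonotopal tiling of $Z(A)$ having both tiles as cells; (3) there is a coherent zonotopal tiling of $Z(A)$ having both tiles as cells; (4) there is a polyhedral subdivision of $A$ having $Y_1\setminus X_2$ and $Y_2\setminus X_1$ as cells; (5) there is a coherent (regular) polyhedral subdivision of $A$ having $Y_1\setminus X_2$ and $Y_2\setminus X_1$ as cells.
   Context: $A=\{a_1,\dots,a_n\}$ affinely spans $\mathbb R^d$; $\pi:\mathbb R^n\to\mathbb R^{d+1}$, $e_i\mapsto(a_i,1)$; $Z(A)=\pi([0,1]^n)$. A tile $[X,Y]$ ($X\subseteq Y\subseteq[n]$) is the interval $\{I:X\subseteq I\subseteq Y\}$ of $2^{[n]}$, geometrically the image under $\pi$ of the face $\{x_i=1\ (i\in X),\ x_i=0\ (i\notin Y)\}$ of $[0,1]^n$. A zonotopal tiling of $Z(A)$ is a polyhedral subdivision of $Z(A)$ all of whose cells are tiles; it is coherent if it equals $\{\pi(F):\exists\tilde w,\ \tilde w|_{\ker\pi}=w|_{\ker\pi},\ ([0,1]^n)^{\tilde w}=F\}$ for some $w\in(\mathbb R^n)^*$ ($Q^{\tilde w}$ the face minimizing $\tilde w$). Polyhedral subdivisions of $A$ have cells recorded as subsets of labels $[n]$; coherent ones are the regular subdivisions (induced by a lifting function). An oriented circuit of $A$ is a pair $(C^+,C^-)$ of disjoint subsets such that $C^+\cup C^-$ is a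 minimal affinely dependent set and some affine dependence $\sum\lambda_ia_i=0,\sum\lambda_i=0$ on it has $C^+=\{\lambda_i>0\}$, $C^-=\{\lambda_i<0\}$. Tiles $[X_1,Y_1]$, $[X_2,Y_2]$ are separated if there is no circuit with $C^+\subseteq Y_1\setminus X_2$, $C^-\subseteq Y_2\setminus X_1$ and $C^+\cup C^-\not\subseteq(Y_1\cap Y_2)\setminus(X_1\cup X_2)$. *)

theory Defs
  imports "HOL-Analysis.Analysis"
begin

section \<open>Labelled point configurations and polyhedral subdivisions\<close>

text \<open>
  A point configuration is a map \<open>p\<close> from a finite type of labels to a Euclidean space, so
  repeated points with different labels are allowed. Cells are sets of labels, of all
  dimensions. A face is cut out by a valid affine inequality; the empty set is a face, hence a
  cell of every subdivision.
\<close>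

definition label_face :: "('l \<Rightarrow> 'b::euclidean_space) \<Rightarrow> 'l set \<Rightarrow> 'l set \<Rightarrow> bool" where
  "label_face p F C \<longleftrightarrow>
     (\<exists>u c. (\<forall>j\<in>C. c \<le> u \<bullet> p j) \<and> F = {j \<in> C. u \<bullet> p j = c})"

definition polyhedral_subdivision :: "('l::finite \<Rightarrow> 'b::euclidean_space) \<Rightarrow> 'l set set \<Rightarrow> bool" where
  "polyhedral_subdivision p S \<longleftrightarrow>
     (\<forall>C\<in>S. \<forall>F. label_face p F C \<longrightarrow> F \<in> S) \<and>
     (\<Union>C\<in>S. convex hull (p ` C)) = convex hull (range p) \<and>
     (\<forall>C\<in>S. \<forall>C'\<in>S. C \<noteq> C' \<longrightarrow>
        rel_interior (convex hull (p ` C)) \<inter> rel_interior (convex hull (p ` C')) = {})"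

text \<open>
  The label sets of the lower faces of the lifted configuration \<open>(p j, h j)\<close>, the empty face
  included.
\<close>

definition lifted_cells :: "('l::finite \<Rightarrow> 'b::euclidean_space) \<Rightarrow> ('l \<Rightarrow> real) \<Rightarrow> 'l set set" where
  "lifted_cells p h =
     {C. \<exists>u c. (\<forall>j. u \<bullet> p j + c \<le> h j) \<and> C = {j. u \<bullet> p j + c = h j}}"

definition coherent_subdivision :: "('l::finite \<Rightarrow> 'b::euclidean_space) \<Rightarrow> 'l set set \<Rightarrow> bool" where
  "coherent_subdivision p S \<longleftrightarrow>
     polyhedral_subdivision p S \<and> (\<exists>h. S = lifted_cells p h)"


section \<open>Circuits and separation\<close>

definition affine_dependence :: "('n::finite \<Rightarrow> 'a::euclidean_space) \<Rightarrow> ('n \<Rightarrow> real) \<Rightarrow> bool" where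
  "affine_dependence a c \<longleftrightarrow> (\<Sum>i\<in>UNIV. c i *\<^sub>R a i) = 0 \<and> (\<Sum>i\<in>UNIV. c i) = 0"

text \<open>
  Dependence of a labelled family: unlike for \<^const>\<open>affine_dependent\<close>, two labels
  of the same point are dependent.
\<close>

definition affinely_dependent_labels :: "('n::finite \<Rightarrow> 'a::euclidean_space) \<Rightarrow> 'n set \<Rightarrow> bool" where
  "affinely_dependent_labels a C \<longleftrightarrow>
     (\<exists>c. affine_dependence a c \<and> {i. c i \<noteq> 0} \<subseteq> C \<and> (\<exists>i. c i \<noteq> 0))"

definition circuit :: "('n::finite \<Rightarrow> 'a::euclidean_space) \<Rightarrow> 'n set \<Rightarrow> 'n set \<Rightarrow> bool" where
  "circuit a Cp Cm \<longleftrightarrow>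
     Cp \<inter> Cm = {} \<and>
     affinely_dependent_labels a (Cp \<union> Cm) \<and>
     (\<forall>D. D \<subset> Cp \<union> Cm \<longrightarrow> \<not> affinely_dependent_labels a D) \<and>
     (\<exists>c. affine_dependence a c \<and> Cp = {i. c i > 0} \<and> Cm = {i. c i < 0})"

definition separated ::
  "('n::finite \<Rightarrow> 'a::euclidean_space) \<Rightarrow> 'n set \<Rightarrow> 'n set \<Rightarrow> 'n set \<Rightarrow> 'n set \<Rightarrow> bool" where
  "separated a X1 Y1 X2 Y2 \<longleftrightarrow>
     \<not> (\<exists>Cp Cm. circuit a Cp Cm \<and> Cp \<subseteq> Y1 - X2 \<and> Cm \<subseteq> Y2 - X1 \<and>
          \<not> Cp \<union> Cm \<subseteq> (Y1 \<inter> Y2) - (X1 \<union> X2))"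


section \<open>Zonotopal tilings\<close>

text \<open>
  The theorem lets \<open>a\<close> affinely span a linear subspace of its type in place of the
  whole space: Euclidean types are never 0-dimensional, and all notions are intrinsic to that
  subspace.
\<close>

definition zproj :: "('n::finite \<Rightarrow> 'a::euclidean_space) \<Rightarrow> real ^ 'n \<Rightarrow> 'a \<times> real" where
  "zproj a x = (\<Sum>i\<in>UNIV. (x $ i) *\<^sub>R (a i, 1))"

definition unit_cube :: "(real ^ 'n::finite) set" where
  "unit_cube = {x. \<forall>i. 0 \<le> x $ i \<and> x $ i \<le> 1}"

definition zonotope :: "('n::finite \<Rightarrow> 'a::euclidean_space) \<Rightarrow> ('a \<times> real) set" where
  "zonotope a = zproj a ` unit_cube"

definition cube_face :: "'n::finite set \<Rightarrow> 'n set \<Rightarrow> (real ^ 'n) set" where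
  "cube_face X Y = {x \<in> unit_cube. (\<forall>i\<in>X. x $ i = 1) \<and> (\<forall>i. i \<notin> Y \<longrightarrow> x $ i = 0)}"

definition cube_vertex :: "'n::finite set \<Rightarrow> real ^ 'n" where
  "cube_vertex I = (\<chi> i. if i \<in> I then 1 else 0)"

text \<open>
  The zonotope is viewed as the configuration of the projected cube vertices, labelled by the
  sets \<open>I\<close>; the tile \<open>[X, Y]\<close> is the interval \<open>{X..Y}\<close> of such labels. Geometrically these are
  the zonotope and the projected cube face:
\<close>

definition zonotope_config :: "('n::finite \<Rightarrow> 'a::euclidean_space) \<Rightarrow> 'n set \<Rightarrow> 'a \<times> real" where
  "zonotope_config a I = zproj a (cube_vertex I)"

lemma linear_zproj: "linear (zproj a)"
  unfolding zproj_def
  by (rule linearI)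
     (simp_all add: scaleR_add_left sum.distrib scaleR_sum_right del: scaleR_Pair)

lemma cube_face_eq_convex_hull:
  assumes "X \<subseteq> Y"
  shows "cube_face X Y = convex hull (cube_vertex ` {X..Y})"
proof (rule antisym)
  show "convex hull (cube_vertex ` {X..Y}) \<subseteq> cube_face X Y"
  proof (rule hull_minimal)
    show "cube_vertex ` {X..Y} \<subseteq> cube_face X Y"
      by (auto simp: cube_face_def unit_cube_def cube_vertex_def)
    show "convex (cube_face X Y)"
    proof (rule convexI)
      fix x y :: "real ^ 'a" and u v :: real
      assume xy: "x \<in> cube_face X Y" "y \<in> cube_face X Y" and uv: "0 \<le> u" "0 \<le> v" "u + v = 1"
      have "u * x $ i + v * y $ i \<le> u * 1 + v * 1" for i
        using xy uv by (intro add_mono mult_left_mono) (auto simp: cube_face_def unit_cube_def)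
      then show "u *\<^sub>R x + v *\<^sub>R y \<in> cube_face X Y"
        using xy uv by (auto simp: cube_face_def unit_cube_def)
    qed
  qed
  have *: "x \<in> convex hull (cube_vertex ` {X..Y})"
    if "x \<in> cube_face X Y" "card {i. x $ i \<notin> {0, 1}} = k" for x :: "real ^ 'a" and k
    using that
  proof (induction k arbitrary: x)
    case 0
    then have "x $ i = 0 \<or> x $ i = 1" for i
      by auto
    then have "x = cube_vertex {i. x $ i = 1}"
      by (auto simp: cube_vertex_def vec_eq_iff)
    moreover have "{i. x $ i = 1} \<in> {X..Y}"
      using 0 by (force simp: cube_face_def)
    ultimately show ?case
      by (metis hull_inc imageI)
  next
    case (Suc k)
    then obtain i where i: "x $ i \<noteq> 0" "x $ i \<noteq> 1"
      by (metis (mono_tags, lifting) Zero_not_Suc card.empty empty_Collect_eq insertCI insertE singletonD)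
    define y where "y r = (\<chi> j. if j = i then r else x $ j)" for r :: real
    have "y r \<in> convex hull (cube_vertex ` {X..Y})" if r: "r = 0 \<or> r = 1" for r
    proof (rule Suc.IH)
      show "y r \<in> cube_face X Y"
        using Suc.prems(1) r i by (auto simp: cube_face_def unit_cube_def y_def)
      have "{j. y r $ j \<notin> {0, 1}} = {j. x $ j \<notin> {0, 1}} - {i}"
        using r by (auto simp: y_def)
      then show "card {j. y r $ j \<notin> {0, 1}} = k"
        using Suc.prems(2) i by (simp add: card_Diff_singleton)
    qed
    then have "(1 - x $ i) *\<^sub>R y 0 + (x $ i) *\<^sub>R y 1 \<in> convex hull (cube_vertex ` {X..Y})"
      using Suc.prems(1) by (intro convexD) (auto simp: cube_face_def unit_cube_def)
    moreover have "(1 - x $ i) *\<^sub>R y 0 + (x $ i) *\<^sub>R y 1 = x"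
      by (auto simp: y_def vec_eq_iff algebra_simps)
    ultimately show ?case
      by simp
  qed
  show "cube_face X Y \<subseteq> convex hull (cube_vertex ` {X..Y})"
    using * by blast
qed

lemma tile_eq_convex_hull:
  "X \<subseteq> Y \<Longrightarrow> zproj a ` cube_face X Y = convex hull (zonotope_config a ` {X..Y})"
  by (simp add: cube_face_eq_convex_hull linear_zproj convex_hull_linear_image image_image
      zonotope_config_def)

lemma zonotope_eq_convex_hull:
  fixes a :: "'n::finite \<Rightarrow> 'a::euclidean_space"
  shows "zonotope a = convex hull (range (zonotope_config a))"
proof -
  have "unit_cube = cube_face {} (UNIV :: 'n set)"
    by (auto simp: cube_face_def)
  moreover have "{{}..UNIV :: 'n set} = UNIV"
    by auto
  ultimately show ?thesis
    using tile_eq_convex_hull[of "{}" UNIV a] by (simp add: zonotope_def)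
qed

text \<open>The empty face belongs to every polyhedral subdivision and is the only cell allowed not to
  be a tile.\<close>

definition zonotopal_tiling ::
  "('n::finite \<Rightarrow> 'a::euclidean_space) \<Rightarrow> 'n set set set \<Rightarrow> bool" where
  "zonotopal_tiling a T \<longleftrightarrow>
     polyhedral_subdivision (zonotope_config a) T \<and>
     (\<forall>C\<in>T. C \<noteq> {} \<longrightarrow> (\<exists>X Y. X \<subseteq> Y \<and> C = {X..Y}))"

definition min_face :: "(real ^ 'n::finite \<Rightarrow> real) \<Rightarrow> (real ^ 'n) set" where
  "min_face w = {x \<in> unit_cube. \<forall>y\<in>unit_cube. w x \<le> w y}"

definition induced_tiles ::
  "('n::finite \<Rightarrow> 'a::euclidean_space) \<Rightarrow> (real ^ 'n \<Rightarrow> real) \<Rightarrow> 'n set set set" where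
  "induced_tiles a w =
     {{X..Y} | X Y. X \<subseteq> Y \<and>
        (\<exists>w'. linear w' \<and> (\<forall>x. zproj a x = 0 \<longrightarrow> w' x = w x) \<and> min_face w' = cube_face X Y)}"

definition coherent_zonotopal_tiling ::
  "('n::finite \<Rightarrow> 'a::euclidean_space) \<Rightarrow> 'n set set set \<Rightarrow> bool" where
  "coherent_zonotopal_tiling a T \<longleftrightarrow>
     zonotopal_tiling a T \<and> (\<exists>w. linear w \<and> T = insert {} (induced_tiles a w))"

end

theory Submission
  imports Defs
begin

text \<open>
  Put \<open>P = Y1 - X2\<close> and \<open>Q = Y2 - X1\<close>. By Motzkin's transposition theorem and the conformal
  decomposition of dependences into circuits, separation yields an affine function \<open>g\<close> that is
  positive on \<open>P - Q\<close>, negative on \<open>Q - P\<close> and zero on \<open>P \<inter> Q\<close>. Lifting by \<open>max 0 g\<close>, raised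
  further off \<open>P \<union> Q\<close>, gives a regular subdivision with cells \<open>P\<close> and \<open>Q\<close>; a weight placed
  coordinatewise below, at, between or above \<open>0\<close> and \<open>g\<close> gives a coherent tiling with both tiles.

  Conversely, a circuit violating separation has a Radon point in the relative interiors of a face
  of \<open>P\<close> and of a face of \<open>Q\<close>; in a subdivision these faces coincide, a contradiction. For tilings,
  collapsing the zone of an element again gives a tiling. Collapse all elements outside the
  circuit with dependence \<open>l\<close>, and let \<open>\<bar>l i\<bar>\<close> be maximal. Collapsing \<open>i\<close> as well leaves a
  parallelepiped, so some tile \<open>r\<close> is free in all directions but possibly \<open>i\<close>. If \<open>r\<close> is
  free in direction \<open>i\<close> too, it is the whole zonotope and both tiles are faces of it. Otherwise,
  by the maximality of \<open>\<bar>l i\<bar>\<close>, the tile \<open>r\<close> contains a vertex of one of the two given tiles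
  that lies on no common face.
\<close>

text \<open>For tilings no Radon point is at hand. Two tiles violating separation may differ off the
  circuit and then lie far apart. Even with all other elements collapsed they need not meet: the
  only dependences left are the multiples of \<open>l\<close>, and at each label where the two tiles
  fix opposite signs a common point would need a multiple with entry of absolute value exactly 2,
  which two labels with different \<open>\<bar>l j\<bar>\<close> cannot both have. Hence the
  contradiction has to come from a third tile \<open>r\<close> that meets one of them.

  Moreover an arbitrary tiling is induced by no height function, so an element cannot be deleted by
  restricting a weight. The collapse of a zone is justified instead by following lines in the
  direction of the deleted vector: along such a line the sign of the tiles at that element never
  decreases.\<close>

section \<open>Farkas and Motzkin alternatives, circuits\<close>

text \<open>The cone generated by the vectors \<open>(q j, h j)\<close>, taken with both signs for
  \<open>j \<in> J\<close>, is finitely generated and hence closed. If it contains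
  \<open>(0, -1)\<close>, the coefficients are the certificate \<open>\<mu>\<close>; otherwise a
  hyperplane separates \<open>(0, -1)\<close> from it and its normal yields
  \<open>y\<close>.\<close>

lemma farkas:
  fixes q :: "'n::finite \<Rightarrow> 'b::euclidean_space"
  assumes "I \<inter> J = {}"
  shows "(\<exists>y. (\<forall>j\<in>I. y \<bullet> q j \<le> h j) \<and> (\<forall>j\<in>J. y \<bullet> q j = h j)) \<or>
    (\<exists>\<mu>. (\<forall>j\<in>I. 0 \<le> \<mu> j) \<and> (\<forall>j. j \<notin> I \<union> J \<longrightarrow> \<mu> j = 0) \<and>
      (\<Sum>j\<in>UNIV. \<mu> j *\<^sub>R q j) = 0 \<and> (\<Sum>j\<in>UNIV. \<mu> j * h j) < 0)"
proof -
  define W where "W = (\<lambda>j. (q j, h j)) ` (I \<union> J) \<union> (\<lambda>j. - (q j, h j)) ` J"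
  define K where "K = convex_cone hull W"
  define M where "M = {\<mu>. (\<forall>j\<in>I. 0 \<le> \<mu> j) \<and> (\<forall>j. j \<notin> I \<union> J \<longrightarrow> \<mu> j = (0::real))}"
  define L where "L \<mu> = (\<Sum>j\<in>UNIV. \<mu> j *\<^sub>R (q j, h j))" for \<mu> :: "'n \<Rightarrow> real"
  have L_single: "L (\<lambda>i. if i = j then c else 0) = c *\<^sub>R (q j, h j)" for j c
    unfolding L_def if_distribR by (simp add: if_distrib[of "\<lambda>c. c *\<^sub>R _"] del: scaleR_Pair cong: if_cong)
  have "K \<subseteq> L ` M"
    unfolding K_def
  proof (rule hull_minimal)
    show "W \<subseteq> L ` M"
    proof
      fix w assume "w \<in> W"
      then consider j where "j \<in> I \<union> J" "w = (q j, h j)" | j where "j \<in> J" "w = - (q j, h j)"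
        by (auto simp: W_def)
      then show "w \<in> L ` M"
      proof cases
        case 1
        then have "w = L (\<lambda>i. if i = j then 1 else 0)" "(\<lambda>i. if i = j then 1 else 0) \<in> M"
          by (auto simp: L_single M_def)
        then show ?thesis by blast
      next
        case 2
        then have "w = L (\<lambda>i. if i = j then - 1 else 0)" "(\<lambda>i. if i = j then - 1 else 0) \<in> M"
          using assms by (auto simp: L_single M_def)
        then show ?thesis by blast
      qed
    qed
    show "convex_cone (L ` M)"
      unfolding convex_cone_iff
    proof (intro conjI ballI allI impI)
      have "L (\<lambda>_. 0) = 0" "(\<lambda>_. 0) \<in> M"
        by (simp_all add: L_def M_def del: scaleR_Pair)
      then show "0 \<in> L ` M"
        by (metis imageI)
    next
      fix x y assume "x \<in> L ` M" "y \<in> L ` M"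
      then obtain \<mu> \<nu> where "\<mu> \<in> M" "\<nu> \<in> M" "x = L \<mu>" "y = L \<nu>"
        by blast
      then have "x + y = L (\<lambda>j. \<mu> j + \<nu> j)" "(\<lambda>j. \<mu> j + \<nu> j) \<in> M"
        by (auto simp: L_def M_def scaleR_add_left sum.distrib simp del: scaleR_Pair)
      then show "x + y \<in> L ` M"
        by blast
    next
      fix x and c :: real assume "x \<in> L ` M" "0 \<le> c"
      then obtain \<mu> where "\<mu> \<in> M" "x = L \<mu>"
        by blast
      then have "c *\<^sub>R x = L (\<lambda>j. c * \<mu> j)" "(\<lambda>j. c * \<mu> j) \<in> M"
        using \<open>0 \<le> c\<close> by (auto simp: L_def M_def scaleR_sum_right simp del: scaleR_Pair)
      then show "c *\<^sub>R x \<in> L ` M"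
        by blast
    qed
  qed
  have K: "convex K" "closed K" "convex_cone K"
    by (auto simp: K_def W_def convex_convex_cone_hull convex_cone_convex_cone_hull
        intro!: closed_convex_cone_hull)
  show ?thesis
  proof (cases "(0, -1) \<in> K")
    case True
    then obtain \<mu> where \<mu>: "\<mu> \<in> M" "(0, -1) = L \<mu>"
      using \<open>K \<subseteq> L ` M\<close> by blast
    then have "(\<Sum>j\<in>UNIV. \<mu> j *\<^sub>R q j) = 0" "(\<Sum>j\<in>UNIV. \<mu> j * h j) = -1"
      by (auto simp: L_def prod_eq_iff fst_sum snd_sum)
    then show ?thesis
      using \<mu>(1) unfolding M_def by (intro disjI2 exI[of _ \<mu>]) auto
  next
    case False
    then obtain a b where ab: "a \<bullet> (0, -1) < b" "\<And>x. x \<in> K \<Longrightarrow> b < a \<bullet> x"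
      using separating_hyperplane_closed_point[OF K(1,2)] by blast
    have "b < 0"
      using ab(2)[of 0] K(3) by (simp add: convex_cone_contains_0)
    have nonneg: "0 \<le> a \<bullet> x" if "x \<in> K" for x
    proof (rule ccontr)
      assume neg: "\<not> 0 \<le> a \<bullet> x"
      have "(b / (a \<bullet> x)) *\<^sub>R x \<in> K"
        using K(3) that neg \<open>b < 0\<close> by (intro convex_cone_scaleR) (auto simp: divide_nonpos_nonpos)
      then show False
        using ab(2) neg by fastforce
    qed
    \<comment> \<open>The functional \<open>a\<close> is nonnegative on the cone and negative at
      \<open>(0, -1)\<close>, so its last coordinate is positive and can be normalised to 1.\<close>
    define t where "t = snd a"
    define y where "y = - fst a /\<^sub>R t"
    have "0 < t"
      using ab(1) \<open>b < 0\<close> by (cases a) (auto simp: t_def)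
    have yq: "y \<bullet> q j = - (fst a \<bullet> q j) / t" for j
      by (simp add: y_def divide_inverse_commute)
    have ge: "0 \<le> fst a \<bullet> q j + t * h j" if "j \<in> I \<union> J" for j
      using nonneg[of "(q j, h j)"] that by (cases a) (auto simp: K_def W_def t_def hull_inc)
    moreover note ge
    moreover have "fst a \<bullet> q j + t * h j \<le> 0" if "j \<in> J" for j
      using nonneg[of "- (q j, h j)"] that by (cases a) (auto simp: K_def W_def t_def hull_inc)
    ultimately have "fst a \<bullet> q j + t * h j = 0" if "j \<in> J" for j
      using that by (meson UnI2 order_antisym)
    then have "y \<bullet> q j = h j" if "j \<in> J" for j
      using that \<open>0 < t\<close> unfolding yq by (simp add: field_simps) (smt (verit))
    moreover have "y \<bullet> q j \<le> h j" if "j \<in> I" for j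
      using ge[of j] that \<open>0 < t\<close> unfolding yq by (simp add: field_simps)
    ultimately show ?thesis
      by blast
  qed
qed

text \<open>Sign conditions are homogeneous in \<open>y\<close>, so each strict inequality may be
  asked to hold with margin 1; this turns them into the weak inequalities of
  \<open>farkas\<close>.\<close>

lemma motzkin_sgn:
  fixes q :: "'n::finite \<Rightarrow> 'b::euclidean_space" and s :: "'n \<Rightarrow> real"
  assumes s: "\<And>j. j \<in> S \<Longrightarrow> s j \<in> {-1, 0, 1}"
  shows "(\<exists>y. \<forall>j\<in>S. sgn (y \<bullet> q j) = s j) \<or>
    (\<exists>\<mu>. (\<forall>j\<in>S. 0 \<le> \<mu> j * s j) \<and> (\<forall>j. j \<notin> S \<longrightarrow> \<mu> j = 0) \<and>
      (\<exists>j\<in>S. 0 < \<mu> j * s j) \<and> (\<Sum>j\<in>UNIV. \<mu> j *\<^sub>R q j) = 0)"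
proof -
  define I where "I = {j\<in>S. s j \<noteq> 0}"
  define J where "J = {j\<in>S. s j = 0}"
  define r where "r j = (if j \<in> I then - s j else 1)" for j
  have "I \<inter> J = {}"
    by (auto simp: I_def J_def)
  then consider y where "\<forall>j\<in>I. y \<bullet> (r j *\<^sub>R q j) \<le> - \<bar>s j\<bar>" "\<forall>j\<in>J. y \<bullet> (r j *\<^sub>R q j) = - \<bar>s j\<bar>"
    | \<nu> where "\<forall>j\<in>I. 0 \<le> \<nu> j" "\<forall>j. j \<notin> I \<union> J \<longrightarrow> \<nu> j = 0"
      "(\<Sum>j\<in>UNIV. \<nu> j *\<^sub>R r j *\<^sub>R q j) = 0" "(\<Sum>j\<in>UNIV. \<nu> j * - \<bar>s j\<bar>) < 0"
    using farkas[of I J "\<lambda>j. r j *\<^sub>R q j" "\<lambda>j. - \<bar>s j\<bar>"] by blast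
  then show ?thesis
  proof cases
    case 1
    have "sgn (y \<bullet> q j) = s j" if "j \<in> S" for j
    proof (cases "j \<in> I")
      case True
      then have "- (s j * (y \<bullet> q j)) \<le> - 1"
        using 1(1) s[OF that] by (auto simp: r_def I_def)
      then show ?thesis
        using s[OF that] True by (auto simp: I_def sgn_if)
    next
      case False
      then show ?thesis
        using 1(2) that by (auto simp: r_def I_def J_def)
    qed
    then show ?thesis
      by blast
  next
    case 2
    define \<mu> where "\<mu> j = - (\<nu> j * r j)" for j
    have "(\<Sum>j\<in>UNIV. \<mu> j *\<^sub>R q j) = 0"
      using 2(3) by (simp add: \<mu>_def sum_negf)
    moreover have pos: "\<mu> j * s j = \<nu> j * \<bar>s j\<bar>" "0 \<le> \<mu> j * s j" if "j \<in> S" for j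
      using s[OF that] 2(1) that by (auto simp: \<mu>_def r_def I_def)
    moreover have zero: "\<mu> j = 0" if "j \<notin> S" for j
      using 2(2) that by (auto simp: \<mu>_def I_def J_def)
    moreover have "\<exists>j\<in>S. 0 < \<mu> j * s j"
    proof (rule ccontr)
      assume "\<not> ?thesis"
      then have "\<nu> j * - \<bar>s j\<bar> \<ge> 0" for j
        using pos 2(2) by (cases "j \<in> S") (force simp: I_def J_def)+
      then show False
        using 2(4) by (meson not_less sum_nonneg)
    qed
    ultimately show ?thesis
      by blast
  qed
qed

text \<open>Induction on the size of the support. A dependence of smaller support allows a reduction
  that reverses no sign of \<open>c\<close> and keeps \<open>k\<close>: either a multiple of it is
  subtracted until a coordinate vanishes, or, being itself compatible with the signs of
  \<open>c\<close> and nonzero at \<open>k\<close>, it replaces \<open>c\<close>.\<close>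

lemma conformal_circuit:
  fixes a :: "'n::finite \<Rightarrow> 'a::euclidean_space"
  assumes "affine_dependence a c" and "c k \<noteq> 0"
  shows "\<exists>Cp Cm. circuit a Cp Cm \<and> Cp \<subseteq> {i. 0 < c i} \<and> Cm \<subseteq> {i. c i < 0} \<and> k \<in> Cp \<union> Cm"
  using assms
proof (induction "card {i. c i \<noteq> 0}" arbitrary: c rule: less_induct)
  case less
  have supp: "{i. c i \<noteq> 0} = {i. 0 < c i} \<union> {i. c i < 0}"
    by auto
  show ?case
  proof (cases "\<exists>D \<subset> {i. c i \<noteq> 0}. affinely_dependent_labels a D")
    case False
    moreover have "affinely_dependent_labels a {i. c i \<noteq> 0}"
      unfolding affinely_dependent_labels_def using less.prems by blast
    ultimately have "circuit a {i. 0 < c i} {i. c i < 0}"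
      unfolding circuit_def supp[symmetric] using less.prems(1) by (auto simp: disjoint_iff)
    then show ?thesis
      using less.prems(2) by (intro exI[of _ "{i. 0 < c i}"] exI[of _ "{i. c i < 0}"]) auto
  next
    case True
    then obtain m where m: "affine_dependence a m" "{i. m i \<noteq> 0} \<subset> {i. c i \<noteq> 0}" "\<exists>i. m i \<noteq> 0"
      unfolding affinely_dependent_labels_def by blast
    have conf: ?thesis
      if m': "affine_dependence a m'" "{i. m' i \<noteq> 0} \<subset> {i. c i \<noteq> 0}" "m' k \<noteq> 0"
        "\<And>i. 0 \<le> m' i * c i" for m'
    proof -
      have "card {i. m' i \<noteq> 0} < card {i. c i \<noteq> 0}"
        using m'(2) by (simp add: psubset_card_mono)
      then obtain Cp Cm where "circuit a Cp Cm" "Cp \<subseteq> {i. 0 < m' i}" "Cm \<subseteq> {i. m' i < 0}" "k \<in> Cp \<union> Cm"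
        using less.hyps[of m'] m' by blast
      moreover have "{i. 0 < m' i} \<subseteq> {i. 0 < c i}"
      proof clarify
        fix i assume "0 < m' i"
        then show "0 < c i"
          using m'(4)[of i] m'(2) by (force simp: zero_le_mult_iff)
      qed
      moreover have "{i. m' i < 0} \<subseteq> {i. c i < 0}"
      proof clarify
        fix i assume "m' i < 0"
        then show "c i < 0"
          using m'(4)[of i] m'(2) by (force simp: zero_le_mult_iff)
      qed
      ultimately show ?thesis
        by (meson order_trans)
    qed
    have red: ?thesis
      if m': "affine_dependence a m'" "{i. m' i \<noteq> 0} \<subset> {i. c i \<noteq> 0}" "\<exists>i. 0 < m' i * c i" "m' k * c k \<le> 0"
      for m'
    proof -
      \<comment> \<open>The least ratio over the coordinates where \<open>m'\<close> and
        \<open>c\<close> have the same sign is the largest \<open>t\<close> for which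
        \<open>c - t * m'\<close> reverses no sign of \<open>c\<close>. At \<open>k\<close> the
        signs do not agree, so the coefficient there does not shrink.\<close>
      define R where "R = (\<lambda>i. c i / m' i) ` {i. 0 < m' i * c i}"
      define t where "t = Min R"
      have R: "finite R" "R \<noteq> {}"
        using m'(3) by (auto simp: R_def)
      then have "t \<in> R"
        unfolding t_def by (rule Min_in)
      then obtain i0 where i0: "0 < m' i0 * c i0" "t = c i0 / m' i0"
        by (auto simp: R_def)
      have tle: "t \<le> c i / m' i" if "0 < m' i * c i" for i
        using R that unfolding t_def by (intro Min_le) (auto simp: R_def)
      have "0 < t"
        using i0 by (auto simp: zero_less_mult_iff zero_less_divide_iff)
      define c' where "c' i = c i - t * m' i" for i
      have dep: "affine_dependence a c'"
        using less.prems(1) m'(1)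
        by (simp add: affine_dependence_def c'_def scaleR_diff_left sum_subtractf
            flip: scaleR_scaleR scaleR_sum_right sum_distrib_left)
      have cc: "0 \<le> c' i * c i" for i
      proof (cases "0 < m' i * c i")
        case True
        have "c' i * c i = (c i / m' i - t) * (m' i * c i)"
          using True by (auto simp: c'_def field_simps)
        then show ?thesis
          using tle[OF True] True by (metis diff_ge_0_iff_ge less_imp_le mult_nonneg_nonneg)
      next
        case False
        have "c' i * c i = c i * c i - t * (m' i * c i)"
          by (simp add: c'_def algebra_simps)
        moreover have "t * (m' i * c i) \<le> 0"
          using False \<open>0 < t\<close> by (simp add: mult_nonneg_nonpos)
        ultimately show ?thesis
          by (smt (verit) zero_le_square)
      qed
      have "c' k \<noteq> 0"
      proof
        assume "c' k = 0"
        then have "c k * c k = t * (m' k * c k)"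
          by (simp add: c'_def)
        also have "\<dots> \<le> 0"
          using m'(4) \<open>0 < t\<close> by (simp add: mult_nonneg_nonpos)
        finally show False
          using less.prems(2) by (smt (verit) mult_eq_0_iff zero_le_square)
      qed
      moreover have "{i. c' i \<noteq> 0} \<subset> {i. c i \<noteq> 0}"
      proof
        show "{i. c' i \<noteq> 0} \<subseteq> {i. c i \<noteq> 0}"
          using m'(2) by (auto simp: c'_def)
        have "i0 \<notin> {i. c' i \<noteq> 0}" "i0 \<in> {i. c i \<noteq> 0}"
          using i0 by (auto simp: c'_def)
        then show "{i. c' i \<noteq> 0} \<noteq> {i. c i \<noteq> 0}"
          by blast
      qed
      ultimately show ?thesis
        using conf[of c'] dep cc by blast
    qed
    have neg: "affine_dependence a (\<lambda>i. - m i)" "{i. - m i \<noteq> 0} = {i. m i \<noteq> 0}"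
      using m(1) by (auto simp: affine_dependence_def sum_negf)
    obtain i1 where i1: "m i1 \<noteq> 0" "c i1 \<noteq> 0"
      using m(2,3) by blast
    \<comment> \<open>If \<open>m k = 0\<close>, one of \<open>m\<close> and \<open>- m\<close>
      shares a sign with \<open>c\<close> somewhere. Otherwise the one opposed to \<open>c\<close>
      at \<open>k\<close> is subtracted; if it agrees in sign with \<open>c\<close> nowhere, its
      negative is already conformal.\<close>
    consider "\<exists>i. 0 < m i * c i" "m k * c k \<le> 0" | "\<exists>i. 0 < - m i * c i" "- m k * c k \<le> 0"
      | "m k \<noteq> 0" "\<And>i. 0 \<le> m i * c i" | "m k \<noteq> 0" "\<And>i. 0 \<le> - m i * c i"
    proof (cases "m k = 0")
      case True
      have "0 < m i1 * c i1 \<or> 0 < - m i1 * c i1"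
        using i1 by (simp add: zero_less_mult_iff mult_less_0_iff) linarith
      then show ?thesis
        using that(1,2) True by auto
    next
      case False
      then show ?thesis
        using that by (smt (verit) mult_minus_left)
    qed
    then show ?thesis
    proof cases
      case 1 then show ?thesis using red[of m] m by blast
    next
      case 2 then show ?thesis using red[of "\<lambda>i. - m i"] m neg by auto
    next
      case 3 then show ?thesis using conf[of m] m by blast
    next
      case 4 then show ?thesis using conf[of "\<lambda>i. - m i"] m neg by auto
    qed
  qed
qed

lemma separated_imp_functional:
  fixes a :: "'n::finite \<Rightarrow> 'a::euclidean_space"
  assumes "separated a X1 Y1 X2 Y2"
  defines "P \<equiv> Y1 - X2" and "Q \<equiv> Y2 - X1"
  shows "\<exists>u c. (\<forall>j\<in>P - Q. 0 < u \<bullet> a j + c) \<and> (\<forall>j\<in>Q - P. u \<bullet> a j + c < 0) \<and>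
    (\<forall>j\<in>P \<inter> Q. u \<bullet> a j + c = 0)"
proof -
  define s :: "'n \<Rightarrow> real" where "s j = (if j \<in> Q then 0 else 1) - (if j \<in> P then 0 else 1)" for j
  have s: "s j \<in> {-1, 0, 1}" for j
    by (simp add: s_def)
  have "\<nexists>\<mu>. (\<forall>j\<in>P \<union> Q. 0 \<le> \<mu> j * s j) \<and> (\<forall>j. j \<notin> P \<union> Q \<longrightarrow> \<mu> j = 0) \<and>
      (\<exists>j\<in>P \<union> Q. 0 < \<mu> j * s j) \<and> (\<Sum>j\<in>UNIV. \<mu> j *\<^sub>R (a j, 1::real)) = 0"
  proof clarify
    fix \<mu> k
    assume nonneg: "\<forall>j\<in>P \<union> Q. 0 \<le> \<mu> j * s j" and supp: "\<forall>j. j \<notin> P \<union> Q \<longrightarrow> \<mu> j = 0"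
      and k: "k \<in> P \<union> Q" "0 < \<mu> k * s k" and "(\<Sum>j\<in>UNIV. \<mu> j *\<^sub>R (a j, 1::real)) = 0"
    then have "affine_dependence a \<mu>"
      by (simp add: affine_dependence_def prod_eq_iff fst_sum snd_sum)
    \<comment> \<open>On \<open>P \<inter> Q\<close> the sign of \<open>\<mu>\<close> is
      unconstrained, so a circuit conformal to \<open>\<mu>\<close> may be harmless. One through
      \<open>k\<close>, which lies outside \<open>P \<inter> Q\<close>, is forbidden by
      separation.\<close>
    then obtain Cp Cm where C: "circuit a Cp Cm" "Cp \<subseteq> {i. 0 < \<mu> i}" "Cm \<subseteq> {i. \<mu> i < 0}" "k \<in> Cp \<union> Cm"
      using conformal_circuit[of a \<mu> k] k(2) by (metis mult_zero_left order_less_irrefl)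
    have "Cp \<subseteq> P"
    proof
      fix j assume "j \<in> Cp"
      then have "0 < \<mu> j"
        using C(2) by blast
      then show "j \<in> P"
        using nonneg supp by (force simp: s_def split: if_splits)
    qed
    moreover have "Cm \<subseteq> Q"
    proof
      fix j assume "j \<in> Cm"
      then have "\<mu> j < 0"
        using C(3) by blast
      then show "j \<in> Q"
        using nonneg supp by (force simp: s_def split: if_splits)
    qed
    moreover have "k \<notin> P \<inter> Q"
      using k(2) by (auto simp: s_def)
    then have "\<not> Cp \<union> Cm \<subseteq> Y1 \<inter> Y2 - (X1 \<union> X2)"
      using C(4) by (auto simp: P_def Q_def)
    ultimately show False
      using assms(1) C(1) unfolding separated_def P_def Q_def by blast
  qed
  then obtain y where y: "\<forall>j\<in>P \<union> Q. sgn (y \<bullet> (a j, 1::real)) = s j"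
    using motzkin_sgn[of "P \<union> Q" s "\<lambda>j. (a j, 1::real)"] s by blast
  have eq: "y \<bullet> (a j, 1) = fst y \<bullet> a j + snd y" for j
    by (cases y) simp
  show ?thesis
  proof (intro exI[of _ "fst y"] exI[of _ "snd y"] conjI ballI)
    fix j assume "j \<in> P - Q"
    then show "0 < fst y \<bullet> a j + snd y"
      using y[rule_format, of j] by (auto simp: s_def eq sgn_1_pos)
  next
    fix j assume "j \<in> Q - P"
    then show "fst y \<bullet> a j + snd y < 0"
      using y[rule_format, of j] by (auto simp: s_def eq sgn_1_neg)
  next
    fix j assume "j \<in> P \<inter> Q"
    then show "fst y \<bullet> a j + snd y = 0"
      using y[rule_format, of j] by (auto simp: s_def eq sgn_0_0)
  qed
qed

section \<open>Regular subdivisions\<close>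

text \<open>Coefficients are attached to labels rather than to points, which keeps repeated points
  of a configuration apart.\<close>

lemma convex_hull_finite_image:
  fixes f :: "'i \<Rightarrow> 'b::real_vector"
  assumes "finite S"
  shows "convex hull (f ` S) = {\<Sum>j\<in>S. l j *\<^sub>R f j | l. (\<forall>j\<in>S. 0 \<le> l j) \<and> sum l S = 1}" (is "_ = ?R")
proof
  show "convex hull (f ` S) \<subseteq> ?R"
  proof (rule hull_minimal)
    show "f ` S \<subseteq> ?R"
    proof clarify
      fix k assume "k \<in> S"
      then have "f k = (\<Sum>j\<in>S. (if j = k then 1 else 0) *\<^sub>R f j)" "(\<Sum>j\<in>S. if j = k then 1 else 0::real) = 1"
        using assms by (simp_all add: if_distrib[of "\<lambda>c. c *\<^sub>R _"] cong: if_cong)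
      then show "\<exists>l. f k = (\<Sum>j\<in>S. l j *\<^sub>R f j) \<and> (\<forall>j\<in>S. 0 \<le> l j) \<and> sum l S = 1"
        by (intro exI[of _ "\<lambda>j. if j = k then 1 else 0"]) auto
    qed
    show "convex ?R"
    proof (rule convexI)
      fix x y and u v :: real
      assume "x \<in> ?R" "y \<in> ?R" and uv: "0 \<le> u" "0 \<le> v" "u + v = 1"
      then obtain l m where l: "x = (\<Sum>j\<in>S. l j *\<^sub>R f j)" "\<forall>j\<in>S. 0 \<le> l j" "sum l S = 1"
        and m: "y = (\<Sum>j\<in>S. m j *\<^sub>R f j)" "\<forall>j\<in>S. 0 \<le> m j" "sum m S = 1"
        by blast
      have "u *\<^sub>R x + v *\<^sub>R y = (\<Sum>j\<in>S. (u * l j + v * m j) *\<^sub>R f j)"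
        by (simp add: l m scaleR_sum_right scaleR_add_left sum.distrib)
      moreover have "(\<Sum>j\<in>S. u * l j + v * m j) = 1"
        using l m uv by (simp add: sum.distrib flip: sum_distrib_left)
      ultimately show "u *\<^sub>R x + v *\<^sub>R y \<in> ?R"
        using l m uv by (auto intro!: exI[of _ "\<lambda>j. u * l j + v * m j"])
    qed
  qed
  show "?R \<subseteq> convex hull (f ` S)"
    using assms by (auto intro!: convex_sum simp: hull_inc)
qed

text \<open>The supporting hyperplane of \<open>C\<close> is tilted by a small multiple
  \<open>t\<close> of the inequality defining \<open>F\<close>. On \<open>C\<close> the slack stays
  nonnegative and vanishes only on \<open>F\<close>; off \<open>C\<close> the slack was positive and
  absorbs the change for small \<open>t\<close>.\<close>

lemma label_face_lifted_cells:
  fixes p :: "'l::finite \<Rightarrow> 'b::euclidean_space"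
  assumes "C \<in> lifted_cells p h" and "label_face p F C"
  shows "F \<in> lifted_cells p h"
proof -
  obtain u c where uc: "\<And>j. u \<bullet> p j + c \<le> h j" "C = {j. u \<bullet> p j + c = h j}"
    using assms(1) by (auto simp: lifted_cells_def)
  obtain v e where ve: "\<And>j. j \<in> C \<Longrightarrow> e \<le> v \<bullet> p j" "F = {j\<in>C. v \<bullet> p j = e}"
    using assms(2) by (auto simp: label_face_def)
  define d where "d j = h j - (u \<bullet> p j + c)" for j
  define w where "w j = e - v \<bullet> p j" for j
  have d: "0 \<le> d j" "d j = 0 \<longleftrightarrow> j \<in> C" for j
    using uc(1)[of j] uc(2) by (auto simp: d_def)
  have w: "w j \<le> 0" "w j = 0 \<longleftrightarrow> j \<in> F" if "j \<in> C" for j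
    using ve that by (auto simp: w_def)
  have "\<forall>j. \<exists>\<epsilon>>0. j \<notin> C \<longrightarrow> \<epsilon> * w j < d j"
  proof
    fix j
    show "\<exists>\<epsilon>>0. j \<notin> C \<longrightarrow> \<epsilon> * w j < d j"
    proof (cases "j \<in> C")
      case False
      then have "0 < d j"
        using d[of j] by simp
      show ?thesis
      proof (intro exI[of _ "d j / (\<bar>w j\<bar> + 1)"] conjI impI)
        show "0 < d j / (\<bar>w j\<bar> + 1)"
          using \<open>0 < d j\<close> by (simp add: add_nonneg_pos)
        have "d j * w j < d j * (\<bar>w j\<bar> + 1)"
          using \<open>0 < d j\<close> by (intro mult_strict_left_mono) auto
        then show "d j / (\<bar>w j\<bar> + 1) * w j < d j"
          by (simp add: divide_less_eq add_nonneg_pos)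
      qed
    qed (auto intro: exI[of _ 1])
  qed
  then obtain \<epsilon> where \<epsilon>: "\<And>j. 0 < \<epsilon> j" "\<And>j. j \<notin> C \<Longrightarrow> \<epsilon> j * w j < d j"
    by metis
  define t where "t = Min (range \<epsilon>)"
  have t: "0 < t" "t \<le> \<epsilon> j" for j
    using \<epsilon>(1) by (auto simp: t_def)
  have out: "t * w j < d j" if "j \<notin> C" for j
  proof (cases "0 \<le> w j")
    case True
    then show ?thesis
      using \<epsilon>(2)[OF that] t(2)[of j] by (smt (verit) mult_right_mono)
  next
    case False
    then show ?thesis
      using t(1) d[of j] that by (smt (verit) mult_pos_neg)
  qed
  have inC: "t * w j \<le> d j" "t * w j = d j \<longleftrightarrow> j \<in> F" if "j \<in> C" for j
    using that d[of j] w[of j] t(1) by (auto simp: mult_le_0_iff)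
  have eq: "(u - t *\<^sub>R v) \<bullet> p j + (c + t * e) = h j + (t * w j - d j)" for j
    by (simp add: inner_diff_left d_def w_def algebra_simps)
  have "F \<subseteq> C"
    using ve(2) by auto
  have "(u - t *\<^sub>R v) \<bullet> p j + (c + t * e) \<le> h j" for j
    unfolding eq using out[of j] inC(1)[of j] by (cases "j \<in> C") auto
  moreover have "(u - t *\<^sub>R v) \<bullet> p j + (c + t * e) = h j \<longleftrightarrow> j \<in> F" for j
    unfolding eq using out[of j] inC(2)[of j] \<open>F \<subseteq> C\<close> by (cases "j \<in> C") auto
  ultimately show ?thesis
    unfolding lifted_cells_def by (intro CollectI exI[of _ "u - t *\<^sub>R v"] exI[of _ "c + t * e"]) auto
qed

text \<open>Linear programming duality: take the lowest point above \<open>x\<close> in the convex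
  hull of the lifted points and let \<open>J\<close> be the labels of positive weight in it. Then
  \<open>farkas\<close> yields an affine minorant of \<open>h\<close> that is tight on
  \<open>J\<close>.\<close>

lemma lifted_cells_cover:
  fixes p :: "'l::finite \<Rightarrow> 'b::euclidean_space"
  assumes "x \<in> convex hull (range p)"
  shows "\<exists>C\<in>lifted_cells p h. x \<in> convex hull (p ` C)"
proof -
  define K where "K = convex hull (range (\<lambda>j. (p j, h j)))"
  have K: "y \<in> K \<longleftrightarrow> (\<exists>l. (\<forall>j. 0 \<le> l j) \<and> sum l UNIV = 1 \<and>
      y = (\<Sum>j\<in>UNIV. l j *\<^sub>R p j, \<Sum>j\<in>UNIV. l j * h j))" for y
    unfolding K_def by (auto simp: convex_hull_finite_image prod_eq_iff fst_sum snd_sum)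
  define Kx where "Kx = K \<inter> {x} \<times> UNIV"
  have "compact Kx"
    unfolding Kx_def K_def
    by (intro compact_Int_closed finite_imp_compact_convex_hull closed_Times) auto
  moreover have "Kx \<noteq> {}"
  proof -
    obtain l where "\<forall>j. 0 \<le> l j" "sum l UNIV = 1" "x = (\<Sum>j\<in>UNIV. l j *\<^sub>R p j)"
      using assms by (auto simp: convex_hull_finite_image)
    then have "(x, \<Sum>j\<in>UNIV. l j * h j) \<in> Kx"
      unfolding Kx_def Int_iff K by (intro conjI exI[of _ l]) auto
    then show ?thesis
      by blast
  qed
  ultimately obtain z where z: "z \<in> Kx" "\<And>y. y \<in> Kx \<Longrightarrow> snd z \<le> snd y"
    using continuous_attains_inf[of Kx snd] continuous_on_snd[OF continuous_on_id] by blast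
  then have "z \<in> K" "fst z = x"
    by (auto simp: Kx_def)
  then obtain l where l: "\<And>j. 0 \<le> l j" "sum l UNIV = 1" "x = (\<Sum>j\<in>UNIV. l j *\<^sub>R p j)"
      "snd z = (\<Sum>j\<in>UNIV. l j * h j)"
    unfolding K by fastforce
  define J where "J = {j. 0 < l j}"
  \<comment> \<open>A small multiple of such a \<open>\<mu>\<close> could be added to the weights:
    the point \<open>x\<close> stays, but the height drops below the minimum.\<close>
  have no: "\<nexists>\<mu>. (\<forall>j\<in>-J. 0 \<le> \<mu> j) \<and> (\<forall>j. j \<notin> -J \<union> J \<longrightarrow> \<mu> j = 0) \<and>
      (\<Sum>j\<in>UNIV. \<mu> j *\<^sub>R (p j, 1::real)) = 0 \<and> (\<Sum>j\<in>UNIV. \<mu> j * h j) < 0"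
  proof clarify
    fix \<mu>
    assume \<mu>: "\<forall>j\<in>-J. 0 \<le> \<mu> j" "(\<Sum>j\<in>UNIV. \<mu> j *\<^sub>R (p j, 1::real)) = 0"
      and neg: "(\<Sum>j\<in>UNIV. \<mu> j * h j) < 0"
    from \<mu>(2) have \<mu>0: "(\<Sum>j\<in>UNIV. \<mu> j *\<^sub>R p j) = 0" "sum \<mu> UNIV = 0"
      by (simp_all add: prod_eq_iff fst_sum snd_sum)
    have "\<forall>j. \<exists>\<epsilon>>0. \<forall>t. 0 \<le> t \<and> t \<le> \<epsilon> \<longrightarrow> 0 \<le> l j + t * \<mu> j"
    proof
      fix j
      show "\<exists>\<epsilon>>0. \<forall>t. 0 \<le> t \<and> t \<le> \<epsilon> \<longrightarrow> 0 \<le> l j + t * \<mu> j"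
      proof (cases "0 \<le> \<mu> j")
        case True
        then show ?thesis
          using l(1)[of j] by (intro exI[of _ 1]) auto
      next
        case False
        then have "0 < l j"
          using \<mu>(1) by (auto simp: J_def)
        then show ?thesis
          using False by (intro exI[of _ "l j / - \<mu> j"]) (auto simp: field_simps)
      qed
    qed
    then obtain \<epsilon> where \<epsilon>: "\<And>j. 0 < \<epsilon> j" "\<And>j t. 0 \<le> t \<Longrightarrow> t \<le> \<epsilon> j \<Longrightarrow> 0 \<le> l j + t * \<mu> j"
      by metis
    define t where "t = Min (range \<epsilon>)"
    have t: "0 < t" "t \<le> \<epsilon> j" for j
      using \<epsilon>(1) by (auto simp: t_def)
    have "(x, snd z + t * (\<Sum>j\<in>UNIV. \<mu> j * h j)) \<in> K"
      unfolding K
    proof (intro exI[of _ "\<lambda>j. l j + t * \<mu> j"] conjI allI)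
      show "0 \<le> l j + t * \<mu> j" for j
        using \<epsilon>(2) t by (simp add: less_imp_le)
      show "(\<Sum>j\<in>UNIV. l j + t * \<mu> j) = 1"
        using l(2) \<mu>0(2) by (simp add: sum.distrib flip: sum_distrib_left)
      have "(\<Sum>j\<in>UNIV. (l j + t * \<mu> j) *\<^sub>R p j) = x + t *\<^sub>R (\<Sum>j\<in>UNIV. \<mu> j *\<^sub>R p j)"
        by (simp add: l(3) scaleR_add_left sum.distrib scaleR_sum_right)
      moreover have "(\<Sum>j\<in>UNIV. (l j + t * \<mu> j) * h j) = snd z + t * (\<Sum>j\<in>UNIV. \<mu> j * h j)"
        by (simp add: l(4) distrib_right sum.distrib sum_distrib_left mult.assoc)
      ultimately show "(x, snd z + t * (\<Sum>j\<in>UNIV. \<mu> j * h j)) =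
          (\<Sum>j\<in>UNIV. (l j + t * \<mu> j) *\<^sub>R p j, \<Sum>j\<in>UNIV. (l j + t * \<mu> j) * h j)"
        using \<mu>0(1) by simp
    qed
    then have "snd z \<le> snd z + t * (\<Sum>j\<in>UNIV. \<mu> j * h j)"
      using z(2) by (force simp: Kx_def)
    then show False
      using t(1) neg by (smt (verit) mult_pos_neg)
  qed
  have "-J \<inter> J = {}" by blast
  from farkas[OF this, of "\<lambda>j. (p j, 1::real)" h] no
  obtain y where y: "\<forall>j\<in>-J. y \<bullet> (p j, 1::real) \<le> h j" "\<forall>j\<in>J. y \<bullet> (p j, 1::real) = h j"
    by blast
  define C where "C = {j. fst y \<bullet> p j + snd y = h j}"
  have yeq: "y \<bullet> (p j, 1) = fst y \<bullet> p j + snd y" for j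
    by (cases y) simp
  have "fst y \<bullet> p j + snd y \<le> h j" for j
    using y unfolding yeq by (cases "j \<in> J") auto
  then have "C \<in> lifted_cells p h"
    unfolding lifted_cells_def C_def by blast
  moreover have JC: "J \<subseteq> C"
    using y(2) unfolding yeq C_def by blast
  have "x = (\<Sum>j\<in>C. l j *\<^sub>R p j)" "sum l C = 1"
  proof -
    have zero: "l j = 0" if "j \<notin> C" for j
      using l(1)[of j] JC that by (force simp: J_def)
    have "(\<Sum>j\<in>UNIV. l j *\<^sub>R p j) = (\<Sum>j\<in>C. l j *\<^sub>R p j)" "sum l UNIV = sum l C"
      by (rule sum.mono_neutral_right; simp add: zero)+
    then show "x = (\<Sum>j\<in>C. l j *\<^sub>R p j)" "sum l C = 1"
      using l by auto
  qed
  then have "x \<in> convex hull (p ` C)"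
    using l(1) by (auto simp: convex_hull_finite_image)
  ultimately show ?thesis
    by blast
qed

lemma convex_hull_image_halfspace_ge:
  assumes "x \<in> convex hull (p ` C)" and "\<And>j. j \<in> C \<Longrightarrow> c \<le> u \<bullet> p j"
  shows "c \<le> u \<bullet> x"
proof -
  have "convex hull (p ` C) \<subseteq> {x. c \<le> u \<bullet> x}"
    using assms(2) by (intro hull_minimal) (auto simp: convex_halfspace_ge)
  then show ?thesis
    using assms(1) by blast
qed

text \<open>The difference of the two affine minorants is nonnegative on \<open>C\<close> and
  nonpositive on \<open>D\<close>, so at \<open>x\<close> it attains its minimum 0 over the hull of
  \<open>C\<close>. A minimum at a relative interior point forces an affine function to be constant,
  so the minorant of \<open>D\<close> is tight on \<open>C\<close> as well.\<close>

lemma lifted_cells_rel_interior: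
  fixes p :: "'l::finite \<Rightarrow> 'b::euclidean_space"
  assumes "C \<in> lifted_cells p h" "D \<in> lifted_cells p h"
    and x: "x \<in> rel_interior (convex hull (p ` C))" "x \<in> convex hull (p ` D)"
  shows "C \<subseteq> D"
proof
  fix k assume "k \<in> C"
  obtain u c where uc: "\<And>j. u \<bullet> p j + c \<le> h j" "C = {j. u \<bullet> p j + c = h j}"
    using assms(1) by (auto simp: lifted_cells_def)
  obtain v e where ve: "\<And>j. v \<bullet> p j + e \<le> h j" "D = {j. v \<bullet> p j + e = h j}"
    using assms(2) by (auto simp: lifted_cells_def)
  have C: "e - c \<le> (u - v) \<bullet> p j" if "j \<in> C" for j
    using ve(1)[of j] uc(2) that by (simp add: inner_diff_left)
  have D: "c - e \<le> (v - u) \<bullet> p j" if "j \<in> D" for j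
    using uc(1)[of j] ve(2) that by (simp add: inner_diff_left)
  have "c - e \<le> (v - u) \<bullet> x"
    using convex_hull_image_halfspace_ge[OF x(2)] D by blast
  then have ux: "(u - v) \<bullet> x \<le> e - c"
    by (simp add: inner_diff_left)
  have "p k \<in> convex hull (p ` C)"
    using \<open>k \<in> C\<close> by (simp add: hull_inc)
  then obtain r where r: "1 < r" "(1 - r) *\<^sub>R p k + r *\<^sub>R x \<in> convex hull (p ` C)"
    using x(1) convex_rel_interior_iff[OF convex_convex_hull, of "p ` C" x] by (metis empty_iff)
  have "e - c \<le> (u - v) \<bullet> ((1 - r) *\<^sub>R p k + r *\<^sub>R x)"
    using convex_hull_image_halfspace_ge[OF r(2)] C by blast
  also have "\<dots> = (1 - r) * ((u - v) \<bullet> p k) + r * ((u - v) \<bullet> x)"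
    by (simp add: inner_add_right)
  also have "\<dots> \<le> (1 - r) * ((u - v) \<bullet> p k) + r * (e - c)"
    using ux r(1) by simp
  finally have "(r - 1) * ((u - v) \<bullet> p k) \<le> (r - 1) * (e - c)"
    by (simp add: algebra_simps)
  then have "(u - v) \<bullet> p k \<le> e - c"
    using r(1) by simp
  then show "k \<in> D"
    using C[OF \<open>k \<in> C\<close>] uc(2) ve(2) \<open>k \<in> C\<close> by (simp add: inner_diff_left)
qed

lemma coherent_subdivision_lifted_cells:
  fixes p :: "'l::finite \<Rightarrow> 'b::euclidean_space"
  shows "coherent_subdivision p (lifted_cells p h)"
  unfolding coherent_subdivision_def polyhedral_subdivision_def
proof (intro conjI ballI allI impI)
  show "F \<in> lifted_cells p h" if "C \<in> lifted_cells p h" "label_face p F C" for C F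
    using label_face_lifted_cells that by blast
  show "(\<Union>C\<in>lifted_cells p h. convex hull (p ` C)) = convex hull (range p)"
  proof
    show "(\<Union>C\<in>lifted_cells p h. convex hull (p ` C)) \<subseteq> convex hull (range p)"
      by (intro UN_least hull_mono) auto
  qed (use lifted_cells_cover in blast)
  show "rel_interior (convex hull (p ` C)) \<inter> rel_interior (convex hull (p ` D)) = {}"
    if "C \<in> lifted_cells p h" "D \<in> lifted_cells p h" "C \<noteq> D" for C D
  proof (rule ccontr)
    assume "\<not> ?thesis"
    then obtain x where "x \<in> rel_interior (convex hull (p ` C))" "x \<in> rel_interior (convex hull (p ` D))"
      by blast
    then have "C \<subseteq> D" "D \<subseteq> C"
      using lifted_cells_rel_interior[OF that(1,2)] lifted_cells_rel_interior[OF that(2,1)]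
      by (blast dest: subsetD[OF rel_interior_subset])+
    then show False
      using \<open>C \<noteq> D\<close> by blast
  qed
qed blast

section \<open>Separation and subdivisions of the point configuration\<close>

lemma separated_imp_coherent_subdivision:
  fixes a :: "'n::finite \<Rightarrow> 'a::euclidean_space"
  assumes "separated a X1 Y1 X2 Y2"
  shows "\<exists>S. coherent_subdivision a S \<and> Y1 - X2 \<in> S \<and> Y2 - X1 \<in> S"
proof -
  define P where "P = Y1 - X2"
  define Q where "Q = Y2 - X1"
  obtain u c where uc: "\<forall>j\<in>P - Q. 0 < u \<bullet> a j + c" "\<forall>j\<in>Q - P. u \<bullet> a j + c < 0"
      "\<forall>j\<in>P \<inter> Q. u \<bullet> a j + c = 0"
    using separated_imp_functional[OF assms] unfolding P_def Q_def by blast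
  define h where "h j = max 0 (u \<bullet> a j + c) + (if j \<in> P \<union> Q then 0 else 1)" for j
  \<comment> \<open>The minorant \<open>u \<bullet> a j + c\<close> is tight exactly on
    \<open>P\<close>, the minorant 0 exactly on \<open>Q\<close>.\<close>
  have "P \<in> lifted_cells a h"
    unfolding lifted_cells_def
  proof (intro CollectI exI[of _ u] exI[of _ c] conjI allI)
    show "u \<bullet> a j + c \<le> h j" for j
      by (simp add: h_def max_def)
    have "j \<in> P \<longleftrightarrow> u \<bullet> a j + c = h j" for j
      using uc by (cases "j \<in> P"; cases "j \<in> Q") (auto simp: h_def max_def not_le dest!: bspec[of _ _ j])
    then show "P = {j. u \<bullet> a j + c = h j}"
      by blast
  qed
  moreover have "Q \<in> lifted_cells a h"
    unfolding lifted_cells_def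
  proof (intro CollectI exI[of _ 0] exI[of _ 0] conjI allI)
    show "0 \<bullet> a j + 0 \<le> h j" for j
      by (simp add: h_def)
    have "j \<in> Q \<longleftrightarrow> 0 = h j" for j
      using uc by (cases "j \<in> P"; cases "j \<in> Q") (auto simp: h_def max_def not_le dest!: bspec[of _ _ j])
    then show "Q = {j. 0 \<bullet> a j + 0 = h j}"
      by auto
  qed
  ultimately show ?thesis
    using coherent_subdivision_lifted_cells unfolding P_def Q_def by blast
qed

text \<open>If \<open>x\<close> is not a relative interior point, a supporting hyperplane at
  \<open>x\<close> cuts \<open>F\<close> in a proper face. This face contains all of
  \<open>D\<close>, because \<open>x\<close> is a combination of the points of \<open>D\<close> with
  strictly positive weights; so the descent ends in a face with \<open>x\<close> in its relative
  interior.\<close>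

lemma rel_interior_cell_containing:
  fixes p :: "'l::finite \<Rightarrow> 'b::euclidean_space"
  assumes "polyhedral_subdivision p S" and "F \<in> S" and "D \<subseteq> F"
    and "\<And>j. j \<in> D \<Longrightarrow> 0 < l j" and "sum l D = 1" and "x = (\<Sum>j\<in>D. l j *\<^sub>R p j)"
  shows "\<exists>G\<in>S. D \<subseteq> G \<and> G \<subseteq> F \<and> x \<in> rel_interior (convex hull (p ` G))"
  using assms(2,3)
proof (induction "card F" arbitrary: F rule: less_induct)
  case less
  have "x \<in> convex hull (p ` D)"
    using assms(4-6) by (force simp: convex_hull_finite_image less_imp_le)
  then have x: "x \<in> convex hull (p ` F)"
    using less.prems(2) by (meson hull_mono image_mono subsetD)
  show ?case
  proof (cases "x \<in> rel_interior (convex hull (p ` F))")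
    case True
    then show ?thesis
      using less.prems by blast
  next
    case False
    obtain w where w: "\<And>y. y \<in> convex hull (p ` F) \<Longrightarrow> w \<bullet> x \<le> w \<bullet> y"
      "\<And>y. y \<in> rel_interior (convex hull (p ` F)) \<Longrightarrow> w \<bullet> x < w \<bullet> y"
      by (rule supporting_hyperplane_rel_boundary[OF convex_convex_hull x False]) blast
    define G where "G = {j\<in>F. w \<bullet> p j = w \<bullet> x}"
    have ge: "w \<bullet> x \<le> w \<bullet> p j" if "j \<in> F" for j
      using w(1) that by (simp add: hull_inc)
    have "label_face p G F"
      unfolding label_face_def G_def using ge by blast
    then have "G \<in> S"
      using assms(1) less.prems(1) unfolding polyhedral_subdivision_def by metis
    have "D \<subseteq> G"
    proof
      fix k assume "k \<in> D"
      have "w \<bullet> x = (\<Sum>j\<in>D. l j * (w \<bullet> p j))"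
        by (simp add: assms(6) inner_sum_right)
      moreover have "w \<bullet> x = (\<Sum>j\<in>D. l j * (w \<bullet> x))"
        using assms(5) by (simp flip: sum_distrib_right)
      ultimately have "(\<Sum>j\<in>D. l j * (w \<bullet> p j - w \<bullet> x)) = 0"
        by (simp add: right_diff_distrib sum_subtractf)
      moreover have "\<forall>j\<in>D. 0 \<le> l j * (w \<bullet> p j - w \<bullet> x)"
        using assms(4) ge less.prems(2) by (auto intro!: mult_nonneg_nonneg simp: less_imp_le)
      ultimately have "l k * (w \<bullet> p k - w \<bullet> x) = 0"
        using \<open>k \<in> D\<close> by (simp add: sum_nonneg_eq_0_iff)
      then show "k \<in> G"
        using assms(4)[OF \<open>k \<in> D\<close>] less.prems(2) \<open>k \<in> D\<close> by (auto simp: G_def)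
    qed
    have "G \<noteq> F"
    proof
      assume "G = F"
      obtain y where y: "y \<in> rel_interior (convex hull (p ` F))"
        using x by (metis all_not_in_conv convex_convex_hull empty_iff rel_interior_eq_empty)
      then have "y \<in> convex hull (p ` F)"
        using rel_interior_subset by blast
      moreover have "- (w \<bullet> x) \<le> (- w) \<bullet> p j" if "j \<in> F" for j
      proof -
        have "j \<in> G"
          using that \<open>G = F\<close> by blast
        then show ?thesis
          by (simp add: G_def)
      qed
      ultimately have "- (w \<bullet> x) \<le> (- w) \<bullet> y"
        by (rule convex_hull_image_halfspace_ge)
      then show False
        using w(2)[OF y] by simp
    qed
    then have "card G < card F"
      by (intro psubset_card_mono) (auto simp: G_def)
    then show ?thesis
      using less.hyps[of G] \<open>G \<in> S\<close> \<open>D \<subseteq> G\<close> by (auto simp: G_def)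
  qed
qed

lemma sum_split_sgn:
  fixes f :: "'n::finite \<Rightarrow> 'b::real_vector" and c :: "'n \<Rightarrow> real"
  assumes "\<And>i. c i = 0 \<Longrightarrow> f i = 0"
  shows "(\<Sum>i\<in>UNIV. f i) = sum f {i. 0 < c i} + sum f {i. c i < 0}"
proof -
  have "(\<Sum>i\<in>UNIV. f i) = sum f ({i. 0 < c i} \<union> {i. c i < 0})"
    using assms by (intro sum.mono_neutral_right) auto
  also have "\<dots> = sum f {i. 0 < c i} + sum f {i. c i < 0}"
    by (intro sum.union_disjoint) auto
  finally show ?thesis .
qed

lemma polyhedral_subdivision_imp_separated:
  fixes a :: "'n::finite \<Rightarrow> 'a::euclidean_space"
  assumes S: "polyhedral_subdivision a S" and "Y1 - X2 \<in> S" and "Y2 - X1 \<in> S"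
  shows "separated a X1 Y1 X2 Y2"
  unfolding separated_def
proof (rule notI, elim exE conjE)
  fix Cp Cm
  assume "circuit a Cp Cm" and sub: "Cp \<subseteq> Y1 - X2" "Cm \<subseteq> Y2 - X1"
    and nsub: "\<not> Cp \<union> Cm \<subseteq> Y1 \<inter> Y2 - (X1 \<union> X2)"
  then obtain c where c: "affine_dependence a c" "Cp = {i. 0 < c i}" "Cm = {i. c i < 0}"
    unfolding circuit_def by blast
  define s where "s = sum c Cp"
  have split: "(\<Sum>i\<in>UNIV. f i) = (\<Sum>i\<in>Cp. f i) + (\<Sum>i\<in>Cm. f i)"
    if "\<And>i. c i = 0 \<Longrightarrow> f i = 0" for f :: "'n \<Rightarrow> 'a"
    unfolding c using that by (rule sum_split_sgn)
  have s': "sum c Cm = - s"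
    using c(1) sum_split_sgn[of c c] by (simp add: affine_dependence_def s_def c)
  have "Cp \<union> Cm \<noteq> {}"
    using nsub by blast
  have "0 < s"
  proof (cases "Cp = {}")
    case True
    then have "sum (\<lambda>i. - c i) Cm > 0"
      using \<open>Cp \<union> Cm \<noteq> {}\<close> by (intro sum_pos) (auto simp: c)
    then show ?thesis
      using s' by (simp add: sum_negf)
  qed (auto simp: s_def c intro!: sum_pos)
  define x where "x = (\<Sum>j\<in>Cp. (c j / s) *\<^sub>R a j)"
  have x': "x = (\<Sum>j\<in>Cm. (- c j / s) *\<^sub>R a j)"
  proof -
    have "(\<Sum>j\<in>Cp. c j *\<^sub>R a j) = - (\<Sum>j\<in>Cm. c j *\<^sub>R a j)"
      using c(1) split[of "\<lambda>j. c j *\<^sub>R a j"] by (simp add: affine_dependence_def eq_neg_iff_add_eq_0)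
    then show ?thesis
      by (simp add: x_def divide_inverse_commute sum_negf flip: scaleR_scaleR scaleR_sum_right)
  qed
  obtain F where F: "F \<in> S" "Cp \<subseteq> F" "F \<subseteq> Y1 - X2" "x \<in> rel_interior (convex hull (a ` F))"
    using rel_interior_cell_containing[OF S assms(2) sub(1), of "\<lambda>j. c j / s" x] \<open>0 < s\<close>
    by (auto simp: c(2) x_def s_def simp flip: sum_divide_distrib)
  obtain G where G: "G \<in> S" "Cm \<subseteq> G" "G \<subseteq> Y2 - X1" "x \<in> rel_interior (convex hull (a ` G))"
    using rel_interior_cell_containing[OF S assms(3) sub(2), of "\<lambda>j. - c j / s" x] \<open>0 < s\<close> x' s'
    by (auto simp: c(3) sum_negf divide_neg_pos simp flip: sum_divide_distrib)
  \<comment> \<open>The relative interiors share the Radon point \<open>x\<close>. The common face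
    contains both sides of the circuit and lies in \<open>(Y1 - X2) \<inter> (Y2 - X1)\<close>,
    which is the set exempted in \<open>separated\<close>.\<close>
  have "F = G"
    using S F G unfolding polyhedral_subdivision_def by blast
  then show False
    using F G nsub by blast
qed

section \<open>Coherent tilings\<close>

lemma zonotope_config_eq: "zonotope_config a I = (\<Sum>i\<in>I. (a i, 1))"
proof -
  have "zonotope_config a I = (\<Sum>i\<in>UNIV. if i \<in> I then (a i, 1) else 0)"
    unfolding zonotope_config_def zproj_def
    by (rule sum.cong) (simp_all add: cube_vertex_def zero_prod_def)
  then show ?thesis
    by (simp add: sum.If_cases)
qed

text \<open>The labels of \<open>Y - X\<close> are decided independently: negative weight goes in,
  positive weight stays out, weight 0 is free. So a linear functional cuts out of a tile a tile
  again.\<close>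

lemma interval_minimizers:
  fixes d :: "'n::finite \<Rightarrow> real"
  assumes "I \<in> {X..Y}"
  defines "N \<equiv> X \<union> {j\<in>Y. d j < 0}"
  shows "sum d N \<le> sum d I"
    and "sum d I = sum d N \<longleftrightarrow> I \<in> {X \<union> {j\<in>Y. d j < 0}..{j\<in>Y. j \<in> X \<or> d j \<le> 0}}"
proof -
  define f where "f j = (if j \<in> I then d j else 0) - (if j \<in> N then d j else 0)" for j
  have diff: "sum d I - sum d N = sum f UNIV"
    by (simp add: f_def sum_subtractf sum.If_cases)
  have f: "0 \<le> f j" for j
    using assms(1) by (auto simp: f_def N_def)
  then have "0 \<le> sum f UNIV"
    by (simp add: sum_nonneg)
  then show "sum d N \<le> sum d I"
    using diff by simp
  have "sum d I = sum d N \<longleftrightarrow> sum f UNIV = 0"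
    using diff by linarith
  also have "\<dots> \<longleftrightarrow> (\<forall>j. f j = 0)"
    using f by (simp add: sum_nonneg_eq_0_iff)
  also have "\<dots> \<longleftrightarrow> I \<in> {X \<union> {j\<in>Y. d j < 0}..{j\<in>Y. j \<in> X \<or> d j \<le> 0}}"
  proof -
    have "f j = 0 \<longleftrightarrow> (j \<in> X \<or> j \<in> Y \<and> d j < 0 \<longrightarrow> j \<in> I) \<and> (j \<in> I \<longrightarrow> j \<in> Y \<and> (j \<in> X \<or> d j \<le> 0))" for j
      using assms(1) by (auto simp: f_def N_def)
    then show ?thesis
      by auto
  qed
  finally show "sum d I = sum d N \<longleftrightarrow> I \<in> {X \<union> {j\<in>Y. d j < 0}..{j\<in>Y. j \<in> X \<or> d j \<le> 0}}" .
qed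

lemma linear_eq_sum_axis:
  fixes w :: "real ^ 'n::finite \<Rightarrow> 'b::real_vector"
  assumes "linear w"
  shows "w x = (\<Sum>i\<in>UNIV. x $ i *\<^sub>R w (axis i 1))"
proof -
  have "w x = w (\<Sum>i\<in>UNIV. x $ i *\<^sub>R axis i 1)"
    by (simp add: basis_expansion flip: scalar_mult_eq_scaleR)
  then show ?thesis
    using assms by (simp add: linear_sum linear_scale)
qed

lemma min_face_linear:
  fixes w :: "real ^ 'n::finite \<Rightarrow> real"
  assumes "linear w"
  shows "min_face w = cube_face {i. w (axis i 1) < 0} {i. w (axis i 1) \<le> 0}"
proof -
  define d where "d i = w (axis i 1)" for i
  define m :: "real ^ 'n" where "m = (\<chi> i. if d i < 0 then 1 else 0)"
  have w: "w x = (\<Sum>i\<in>UNIV. x $ i * d i)" for x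
    using linear_eq_sum_axis[OF assms, of x] by (simp add: d_def)
  have m: "m \<in> unit_cube"
    by (simp add: m_def unit_cube_def)
  have diff: "w x - w m = (\<Sum>i\<in>UNIV. (x $ i - m $ i) * d i)" for x
    by (simp add: w left_diff_distrib sum_subtractf)
  have nonneg: "0 \<le> (x $ i - m $ i) * d i" if "x \<in> unit_cube" for x i
    using that by (auto simp: m_def unit_cube_def mult_nonpos_nonpos)
  have le: "w m \<le> w x" if "x \<in> unit_cube" for x
    using diff[of x] nonneg[OF that] by (smt (verit) sum_nonneg)
  have "x \<in> min_face w \<longleftrightarrow> x \<in> unit_cube \<and> w x = w m" for x
    using le m unfolding min_face_def by force
  moreover have "w x = w m \<longleftrightarrow> (\<forall>i. (x $ i - m $ i) * d i = 0)" if "x \<in> unit_cube" for x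
  proof -
    have "w x = w m \<longleftrightarrow> (\<Sum>i\<in>UNIV. (x $ i - m $ i) * d i) = 0"
      using diff[of x] by linarith
    then show ?thesis
      using nonneg[OF that] by (simp add: sum_nonneg_eq_0_iff del: mult_eq_0_iff)
  qed
  moreover have "(\<forall>i. (x $ i - m $ i) * d i = 0) \<longleftrightarrow>
      (\<forall>i. d i < 0 \<longrightarrow> x $ i = 1) \<and> (\<forall>i. \<not> d i \<le> 0 \<longrightarrow> x $ i = 0)" for x
  proof -
    have "(x $ i - m $ i) * d i = 0 \<longleftrightarrow> (d i < 0 \<longrightarrow> x $ i = 1) \<and> (\<not> d i \<le> 0 \<longrightarrow> x $ i = 0)" for i
      by (auto simp: m_def)
    then show ?thesis
      by blast
  qed
  ultimately show ?thesis
    unfolding cube_face_def d_def[symmetric] by auto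
qed

lemma cube_face_inject:
  assumes "cube_face X Y = cube_face X' Y'" "X \<subseteq> Y" "X' \<subseteq> Y'"
  shows "X = X' \<and> Y = Y'"
proof -
  have "I \<in> {X..Y} \<longleftrightarrow> cube_vertex I \<in> cube_face X Y" for I and X Y :: "'a set"
    by (auto simp: cube_face_def unit_cube_def cube_vertex_def)
  then have "{X..Y} = {X'..Y'}"
    using assms(1) by blast
  then show ?thesis
    using assms(2,3) by (simp add: Icc_eq_Icc)
qed

text \<open>The case of \<open>farkas\<close> with equalities only: the second alternative would be
  a vector in the kernel of \<open>zproj a\<close> on which \<open>w\<close> is negative.\<close>

lemma functional_factors_zproj:
  fixes a :: "'n::finite \<Rightarrow> 'a::euclidean_space"
  assumes "linear w" and ker: "\<And>x. zproj a x = 0 \<Longrightarrow> w x = 0"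
  shows "\<exists>u. \<forall>i. u \<bullet> (a i, 1::real) = (w (axis i 1) :: real)"
proof -
  have w: "w x = (\<Sum>i\<in>UNIV. x $ i * w (axis i 1))" for x
    using linear_eq_sum_axis[OF assms(1), of x] by simp
  have "\<nexists>\<mu>. (\<Sum>j\<in>UNIV. \<mu> j *\<^sub>R (a j, 1::real)) = 0 \<and> (\<Sum>j\<in>UNIV. \<mu> j * w (axis j 1)) < 0"
  proof clarify
    fix \<mu> assume \<mu>: "(\<Sum>j\<in>UNIV. \<mu> j *\<^sub>R (a j, 1::real)) = 0" "(\<Sum>j\<in>UNIV. \<mu> j * w (axis j 1)) < 0"
    then have "zproj a (\<chi> j. \<mu> j) = 0"
      by (simp add: zproj_def)
    then show False
      using ker[of "\<chi> j. \<mu> j"] w[of "\<chi> j. \<mu> j"] \<mu>(2) by simp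
  qed
  then show ?thesis
    using farkas[of "{}" UNIV "\<lambda>j. (a j, 1::real)" "\<lambda>j. w (axis j 1)"] by blast
qed

lemma zproj_axis: "zproj a (axis i 1) = (a i, 1)"
proof -
  have "zproj a (axis i 1) = (\<Sum>j\<in>UNIV. if j = i then (a i, 1) else 0)"
    unfolding zproj_def by (rule sum.cong) (auto simp: axis_def zero_prod_def)
  then show ?thesis
    by simp
qed

text \<open>A linear functional agreeing with \<open>w\<close> on the kernel of
  \<open>zproj a\<close> is \<open>w\<close> minus some \<open>u \<bullet> zproj a x\<close>.
  Minimising it over the cube amounts to supporting the heights \<open>w (cube_vertex I)\<close>
  from below with slope \<open>u\<close>. So coherent tilings are regular subdivisions of the
  zonotope configuration, and the results on \<open>lifted_cells\<close> apply to them.\<close>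

lemma induced_tiles_eq_lifted_cells:
  fixes a :: "'n::finite \<Rightarrow> 'a::euclidean_space"
  assumes w: "linear w"
  shows "insert {} (induced_tiles a w) = lifted_cells (zonotope_config a) (\<lambda>I. \<Sum>i\<in>I. w (axis i 1))"
    (is "?L = ?R")
proof
  have lifted: "C \<in> ?R \<longleftrightarrow> (\<exists>u c. (\<forall>I. c \<le> (\<Sum>i\<in>I. w (axis i 1) - u \<bullet> (a i, 1::real))) \<and>
      C = {I. (\<Sum>i\<in>I. w (axis i 1) - u \<bullet> (a i, 1::real)) = c})" for C
    unfolding lifted_cells_def zonotope_config_eq inner_sum_right sum_subtractf mem_Collect_eq
    by (simp add: algebra_simps eq_commute)
  show "?L \<subseteq> ?R"
  proof
    fix C assume "C \<in> ?L"
    then consider "C = {}" | X Y w' where "C = {X..Y}" "X \<subseteq> Y" "linear w'"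
      "\<And>x. zproj a x = 0 \<Longrightarrow> w' x = w x" "min_face w' = cube_face X Y"
      by (auto simp: induced_tiles_def)
    then show "C \<in> ?R"
    proof cases
      case 1
      \<comment> \<open>A hyperplane strictly below all lifted points gives the empty cell.\<close>
      define c where "c = Min (range (\<lambda>I. \<Sum>i\<in>I. w (axis i 1))) - 1"
      have lt: "c < (\<Sum>i\<in>I. w (axis i 1))" for I
        unfolding c_def by (simp add: less_le_not_le) (smt (verit) Min_le finite finite_imageI rangeI)
      show ?thesis
        unfolding lifted
        by (rule exI[of _ 0], rule exI[of _ c]) (use lt 1 in \<open>auto simp: less_imp_le less_imp_neq[symmetric]\<close>)
    next
      case (2 X Y w')
      have "linear (\<lambda>x. w x - w' x)"
        using w 2(3) by (rule linear_compose_sub)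
      then obtain u where u: "\<And>i. u \<bullet> (a i, 1::real) = w (axis i 1) - w' (axis i 1)"
        using functional_factors_zproj[of "\<lambda>x. w x - w' x" a] 2(4) by (metis right_minus_eq)
      have "cube_face X Y = cube_face {i. w' (axis i 1) < 0} {i. w' (axis i 1) \<le> 0}"
        using 2(5) min_face_linear[OF 2(3)] by simp
      then have XY: "X = {i. w' (axis i 1) < 0} \<and> Y = {i. w' (axis i 1) \<le> 0}"
        using 2(2) by (rule cube_face_inject) auto
      have "w (axis i 1) - u \<bullet> (a i, 1::real) = w' (axis i 1)" for i
        using u by simp
      moreover have "(\<Sum>i\<in>X. w' (axis i 1)) \<le> (\<Sum>i\<in>I. w' (axis i 1))"
        "(\<Sum>i\<in>I. w' (axis i 1)) = (\<Sum>i\<in>X. w' (axis i 1)) \<longleftrightarrow> I \<in> {X..Y}" for I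
        using interval_minimizers[of I "{}" UNIV "\<lambda>i. w' (axis i 1)"] XY by simp_all
      ultimately show ?thesis
        unfolding lifted 2(1)
        by (intro exI[of _ u] exI[of _ "\<Sum>i\<in>X. w' (axis i 1)"]) (simp add: set_eq_iff)
    qed
  qed
  show "?R \<subseteq> ?L"
  proof
    fix C assume "C \<in> ?R"
    then obtain u c where uc: "\<And>I. c \<le> (\<Sum>i\<in>I. w (axis i 1) - u \<bullet> (a i, 1::real))"
        "C = {I. (\<Sum>i\<in>I. w (axis i 1) - u \<bullet> (a i, 1::real)) = c}"
      unfolding lifted by blast
    show "C \<in> ?L"
    proof (cases "C = {}")
      case False
      define d where "d i = w (axis i 1) - u \<bullet> (a i, 1::real)" for i
      define w' where "w' x = w x - u \<bullet> zproj a x" for x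
      have lin: "linear w'"
        unfolding w'_def
        by (intro linear_compose_sub w linear_compose[OF linear_zproj, unfolded o_def]
            bounded_linear.linear bounded_linear_inner_right)
      have "w' (axis i 1) = d i" for i
        by (simp add: w'_def d_def zproj_axis)
      then have face: "min_face w' = cube_face {i. d i < 0} {i. d i \<le> 0}"
        using min_face_linear[OF lin] by simp
      obtain I where "I \<in> C"
        using False by blast
      then have "sum d {i. d i < 0} = c"
        using uc(1)[of "{i. d i < 0}"] uc(2) interval_minimizers(1)[of I "{}" UNIV d]
        by (simp flip: d_def)
      then have "C = {{i. d i < 0}..{i. d i \<le> 0}}"
        using interval_minimizers(2)[of _ "{}" UNIV d] by (auto simp: uc(2) simp flip: d_def)
      moreover have "\<forall>x. zproj a x = 0 \<longrightarrow> w' x = w x"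
        by (simp add: w'_def)
      moreover have "{i. d i < 0} \<subseteq> {i. d i \<le> 0}"
        by auto
      ultimately show ?thesis
        unfolding induced_tiles_def using lin face by blast
    qed simp
  qed
qed

lemma coherent_zonotopal_tiling_induced:
  fixes a :: "'n::finite \<Rightarrow> 'a::euclidean_space"
  assumes "linear w"
  shows "coherent_zonotopal_tiling a (insert {} (induced_tiles a w))"
proof -
  have "polyhedral_subdivision (zonotope_config a) (insert {} (induced_tiles a w))"
    using coherent_subdivision_lifted_cells
    unfolding induced_tiles_eq_lifted_cells[OF assms] coherent_subdivision_def by blast
  then show ?thesis
    unfolding coherent_zonotopal_tiling_def zonotopal_tiling_def
    using assms by (auto simp: induced_tiles_def)
qed

lemma separated_imp_coherent_tiling:
  fixes a :: "'n::finite \<Rightarrow> 'a::euclidean_space"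
  assumes sep: "separated a X1 Y1 X2 Y2" and "X1 \<subseteq> Y1" "X2 \<subseteq> Y2"
  shows "\<exists>T. coherent_zonotopal_tiling a T \<and> {X1..Y1} \<in> T \<and> {X2..Y2} \<in> T"
proof -
  define P where "P = Y1 - X2"
  define Q where "Q = Y2 - X1"
  obtain u c where uc: "\<forall>j\<in>P - Q. 0 < u \<bullet> a j + c" "\<forall>j\<in>Q - P. u \<bullet> a j + c < 0"
      "\<forall>j\<in>P \<inter> Q. u \<bullet> a j + c = 0"
    using separated_imp_functional[OF sep] unfolding P_def Q_def by blast
  define g where "g j = u \<bullet> a j + c" for j
  have "\<exists>d. (d < g j \<longleftrightarrow> j \<in> X1) \<and> (d \<le> g j \<longleftrightarrow> j \<in> Y1) \<and> (d < 0 \<longleftrightarrow> j \<in> X2) \<and> (d \<le> 0 \<longleftrightarrow> j \<in> Y2)" for j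
  proof -
    \<comment> \<open>The functional \<open>w\<close> will have coordinate \<open>d j\<close> and
      \<open>w'\<close> coordinate \<open>d j - g j\<close>. So the position of \<open>d j\<close>
      relative to 0 encodes the second tile, and that relative to \<open>g j\<close> the first. In
      the last case \<open>d j\<close> must lie strictly between 0 and \<open>g j\<close>, in the
      order given by the sign of \<open>g j\<close>.\<close>
    define t where "t = (if j \<in> X1 \<and> j \<in> X2 then min 0 (g j) - 1
      else if j \<notin> Y1 \<and> j \<notin> Y2 then max 0 (g j) + 1
      else if j \<in> Y1 - X1 then g j else if j \<in> Y2 - X2 then 0 else g j / 2)"
    have "j \<in> P - Q \<longrightarrow> 0 < g j" "j \<in> Q - P \<longrightarrow> g j < 0" "j \<in> P \<inter> Q \<longrightarrow> g j = 0"
      using uc by (auto simp: g_def)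
    then have "(t < g j \<longleftrightarrow> j \<in> X1) \<and> (t \<le> g j \<longleftrightarrow> j \<in> Y1) \<and> (t < 0 \<longleftrightarrow> j \<in> X2) \<and> (t \<le> 0 \<longleftrightarrow> j \<in> Y2)"
      using assms(2,3) unfolding t_def P_def Q_def
      by (cases "j \<in> X1"; cases "j \<in> X2"; cases "j \<in> Y1"; cases "j \<in> Y2") auto
    then show ?thesis
      by blast
  qed
  then obtain d where d: "\<And>j. d j < g j \<longleftrightarrow> j \<in> X1" "\<And>j. d j \<le> g j \<longleftrightarrow> j \<in> Y1"
      "\<And>j. d j < 0 \<longleftrightarrow> j \<in> X2" "\<And>j. d j \<le> 0 \<longleftrightarrow> j \<in> Y2"
    by metis
  define w where "w x = (\<Sum>i\<in>UNIV. x $ i * d i)" for x :: "real ^ 'n"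
  have w_axis: "w (axis i 1) = d i" for i
  proof -
    have "w (axis i 1) = (\<Sum>j\<in>UNIV. if j = i then d i else 0)"
      unfolding w_def by (rule sum.cong) (auto simp: axis_def)
    then show ?thesis
      by simp
  qed
  have w: "linear w"
    by (rule linearI) (simp_all add: w_def distrib_right sum.distrib sum_distrib_left mult.assoc)
  have "{X2..Y2} \<in> induced_tiles a w"
  proof -
    have "min_face w = cube_face X2 Y2"
      by (simp add: min_face_linear[OF w] w_axis d)
    then show ?thesis
      unfolding induced_tiles_def using w assms(3) by blast
  qed
  moreover have "{X1..Y1} \<in> induced_tiles a w"
  proof -
    define w' where "w' x = w x - (u, c) \<bullet> zproj a x" for x
    have lin: "linear w'"
      unfolding w'_def
      by (intro linear_compose_sub w linear_compose[OF linear_zproj, unfolded o_def]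
          bounded_linear.linear bounded_linear_inner_right)
    have "w' (axis i 1) = d i - g i" for i
      by (simp add: w'_def w_axis g_def zproj_axis)
    then have "min_face w' = cube_face X1 Y1"
      by (simp add: min_face_linear[OF lin] d)
    moreover have "\<forall>x. zproj a x = 0 \<longrightarrow> w' x = w x"
      by (simp add: w'_def)
    ultimately show ?thesis
      unfolding induced_tiles_def using lin assms(2) by blast
  qed
  ultimately show ?thesis
    using coherent_zonotopal_tiling_induced[OF w, of a] by blast
qed

section \<open>Tilings by sign vectors\<close>

text \<open>
  Rescaling the cube \<open>[0,1]\<^sup>n\<close> to \<open>[-1,1]\<^sup>n\<close> makes tiles symmetric: \<open>[X, Y]\<close> becomes the sign
  vector that is \<open>1\<close> on \<open>X\<close>, \<open>-1\<close> off \<open>Y\<close> and \<open>0\<close> on the free coordinates. Deleting an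
  element amounts to setting its vector and its signs to \<open>0\<close>.
\<close>

definition lcomb :: "('n::finite \<Rightarrow> 'b::euclidean_space) \<Rightarrow> ('n \<Rightarrow> real) \<Rightarrow> 'b" where
  "lcomb v x = (\<Sum>j\<in>UNIV. x j *\<^sub>R v j)"

definition closed_rep :: "('n \<Rightarrow> real) \<Rightarrow> ('n \<Rightarrow> real) \<Rightarrow> bool" where
  "closed_rep s x \<longleftrightarrow> (\<forall>j. if s j = 0 then \<bar>x j\<bar> \<le> 1 else x j = s j)"

definition open_rep :: "('n \<Rightarrow> real) \<Rightarrow> ('n \<Rightarrow> real) \<Rightarrow> bool" where
  "open_rep s x \<longleftrightarrow> (\<forall>j. if s j = 0 then \<bar>x j\<bar> < 1 else x j = s j)"

definition ccell :: "('n::finite \<Rightarrow> 'b::euclidean_space) \<Rightarrow> ('n \<Rightarrow> real) \<Rightarrow> 'b set" where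
  "ccell v s = lcomb v ` {x. closed_rep s x}"

definition ocell :: "('n::finite \<Rightarrow> 'b::euclidean_space) \<Rightarrow> ('n \<Rightarrow> real) \<Rightarrow> 'b set" where
  "ocell v s = lcomb v ` {x. open_rep s x}"

text \<open>The minus sign selects the face on which \<open>u\<close> is minimal.\<close>

definition sface :: "('n \<Rightarrow> 'b::euclidean_space) \<Rightarrow> 'b \<Rightarrow> ('n \<Rightarrow> real) \<Rightarrow> 'n \<Rightarrow> real" where
  "sface v u s = (\<lambda>j. if s j = 0 then - sgn (u \<bullet> v j) else s j)"

text \<open>Disjointness of the open cells together with closure under faces encodes the
  face-to-face condition.\<close>

definition sign_tiling :: "('n::finite \<Rightarrow> 'b::euclidean_space) \<Rightarrow> ('n \<Rightarrow> real) set \<Rightarrow> bool" where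
  "sign_tiling v T \<longleftrightarrow>
     (\<forall>s\<in>T. \<forall>j. s j \<in> {-1, 0, 1}) \<and>
     (\<forall>x. (\<forall>j. \<bar>x j\<bar> \<le> 1) \<longrightarrow> (\<exists>s\<in>T. lcomb v x \<in> ccell v s)) \<and>
     (\<forall>s\<in>T. \<forall>s'\<in>T. \<forall>z\<in>ocell v s. z \<in> ocell v s' \<longrightarrow> s = s') \<and>
     (\<forall>s\<in>T. \<forall>u. sface v u s \<in> T)"

lemma lcomb_add: "lcomb v (\<lambda>j. x j + y j) = lcomb v x + lcomb v y"
  by (simp add: lcomb_def scaleR_add_left sum.distrib)

lemma lcomb_scale: "lcomb v (\<lambda>j. c * x j) = c *\<^sub>R lcomb v x"
  by (simp add: lcomb_def scaleR_sum_right)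

lemma lcomb_upd: "lcomb v (x(i := c)) = lcomb v x + (c - x i) *\<^sub>R v i"
proof -
  have "lcomb v (x(i := c)) - lcomb v x = (\<Sum>j\<in>UNIV. if j = i then (c - x i) *\<^sub>R v i else 0)"
    unfolding lcomb_def sum_subtractf[symmetric] by (rule sum.cong) (auto simp: scaleR_diff_left)
  then show ?thesis
    by (simp add: algebra_simps)
qed

lemma lcomb_vec_upd: "lcomb (v(i := 0)) x = lcomb v (x(i := 0))"
  unfolding lcomb_def by (rule sum.cong) auto

lemma inner_lcomb: "u \<bullet> lcomb v x = (\<Sum>j\<in>UNIV. x j * (u \<bullet> v j))"
  by (simp add: lcomb_def inner_sum_right)

lemma closed_repD: "closed_rep s x \<Longrightarrow> if s j = 0 then \<bar>x j\<bar> \<le> 1 else x j = s j"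
  unfolding closed_rep_def by (rule spec)

lemma open_repD: "open_rep s x \<Longrightarrow> if s j = 0 then \<bar>x j\<bar> < 1 else x j = s j"
  unfolding open_rep_def by (rule spec)

lemma open_imp_closed_rep:
  assumes "open_rep s x"
  shows "closed_rep s x"
  unfolding closed_rep_def
proof
  show "if s j = 0 then \<bar>x j\<bar> \<le> 1 else x j = s j" for j
    using open_repD[OF assms, of j] by (simp split: if_splits)
qed

lemma ocell_subset_ccell: "ocell v s \<subseteq> ccell v s"
  by (auto simp: ocell_def ccell_def open_imp_closed_rep)

lemma open_rep_shift:
  assumes "open_rep s x" "s i = 0" "\<bar>c\<bar> < 1"
  shows "open_rep s (x(i := c))"
  using open_repD[OF assms(1)] assms(2,3) unfolding open_rep_def by simp

lemma closed_rep_cube: "closed_rep s x \<Longrightarrow> s j \<in> {-1, 0, 1} \<Longrightarrow> \<bar>x j\<bar> \<le> 1"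
  by (drule closed_repD[where j = j]) (auto split: if_splits)

lemma closed_rep_convex:
  assumes "closed_rep s x" "closed_rep s y" "0 \<le> a" "0 \<le> b" "a + b = 1"
  shows "closed_rep s (\<lambda>j. a * x j + b * y j)"
  unfolding closed_rep_def
proof
  fix j
  show "if s j = 0 then \<bar>a * x j + b * y j\<bar> \<le> 1 else a * x j + b * y j = s j"
  proof (cases "s j = 0")
    case True
    then have "\<bar>x j\<bar> \<le> 1" "\<bar>y j\<bar> \<le> 1"
      using closed_repD[OF assms(1), of j] closed_repD[OF assms(2), of j] by simp_all
    then have "a * \<bar>x j\<bar> + b * \<bar>y j\<bar> \<le> a * 1 + b * 1"
      using assms(3,4) by (intro add_mono mult_left_mono) auto
    moreover have "\<bar>a * x j + b * y j\<bar> \<le> a * \<bar>x j\<bar> + b * \<bar>y j\<bar>"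
      using assms(3,4) abs_triangle_ineq[of "a * x j" "b * y j"] by (simp add: abs_mult)
    ultimately show ?thesis
      using assms(5) True by simp
  next
    case False
    then have "x j = s j" "y j = s j"
      using closed_repD[OF assms(1), of j] closed_repD[OF assms(2), of j] by simp_all
    then show ?thesis
      using False assms(5) by (simp flip: distrib_right)
  qed
qed

lemma compact_ccell:
  fixes v :: "'n::finite \<Rightarrow> 'b::euclidean_space"
  shows "compact (ccell v s)"
proof -
  define K :: "(real ^ 'n) set" where "K = {x. \<forall>j. x $ j \<in> (if s j = 0 then {-1..1} else {s j})}"
  have Kj: "x $ j \<in> (if s j = 0 then {-1..1} else {s j})" if "x \<in> K" for x j
    using that unfolding K_def by blast
  have "compact K"
    unfolding compact_eq_bounded_closed
  proof
    have "norm x \<le> real CARD('n) * max 1 (Max (range (\<lambda>j. \<bar>s j\<bar>)))" if "x \<in> K" for x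
    proof -
      have "\<bar>x $ j\<bar> \<le> max 1 (Max (range (\<lambda>j. \<bar>s j\<bar>)))" for j
      proof (cases "s j = 0")
        case True
        then have "\<bar>x $ j\<bar> \<le> 1"
          using Kj[OF that, of j] by (simp add: abs_le_iff minus_le_iff)
        then show ?thesis
          by simp
      next
        case False
        then have "x $ j = s j"
          using Kj[OF that, of j] by simp
        moreover have "\<bar>s j\<bar> \<le> Max (range (\<lambda>j. \<bar>s j\<bar>))"
          by (intro Max_ge) auto
        ultimately show ?thesis
          by (simp only: max.coboundedI2)
      qed
      then have "(\<Sum>j\<in>UNIV. \<bar>x $ j\<bar>) \<le> real CARD('n) * max 1 (Max (range (\<lambda>j. \<bar>s j\<bar>)))"
        using sum_bounded_above[of UNIV "\<lambda>j. \<bar>x $ j\<bar>"] by simp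
      then show ?thesis
        using norm_le_l1_cart[of x] by simp
    qed
    then show "bounded K"
      by (auto simp: bounded_iff)
    have "K = (\<Inter>j. {x. x $ j \<in> (if s j = 0 then {-1..1} else {s j})})"
      unfolding K_def by blast
    moreover have "closed {x::real ^ 'n. x $ j \<in> (if s j = 0 then {-1..1} else {s j})}" for j
      using continuous_closed_vimage[of "if s j = 0 then {-1..1} else {s j}" "\<lambda>x. x $ j"]
      by (simp add: vimage_def)
    ultimately show "closed K"
      by (simp add: closed_INT del: INT_simps mem_Collect_eq)
  qed
  moreover have "ccell v s = (\<lambda>x. \<Sum>j\<in>UNIV. (x $ j) *\<^sub>R v j) ` K"
  proof -
    have K: "y \<in> K \<longleftrightarrow> closed_rep s (vec_nth y)" for y
      unfolding K_def closed_rep_def mem_Collect_eq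
      by (intro arg_cong[of _ _ All] ext) auto
    have "{x. closed_rep s x} = vec_nth ` K"
    proof (intro set_eqI iffI)
      fix x assume "x \<in> {x. closed_rep s x}"
      then have "(\<chi> j. x j) \<in> K" "x = vec_nth (\<chi> j. x j)"
        by (simp_all add: K eta_contract_eq vec_lambda_inverse)
      then show "x \<in> vec_nth ` K"
        by blast
    qed (auto simp: K)
    then show ?thesis
      by (simp add: ccell_def lcomb_def image_image)
  qed
  ultimately show ?thesis
    by (auto intro!: compact_continuous_image continuous_intros)
qed

text \<open>Each coordinate contributes a nonnegative amount to the difference, so equality makes
  each of them optimal. Hence every representation of a minimal point, not just one of them, has the
  signs of the face.\<close>

lemma sface_minimal:
  assumes "closed_rep s y" and "closed_rep (sface v u s) x"
  shows "u \<bullet> lcomb v x \<le> u \<bullet> lcomb v y"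
    and "u \<bullet> lcomb v y = u \<bullet> lcomb v x \<Longrightarrow> closed_rep (sface v u s) y"
proof -
  have diff: "u \<bullet> lcomb v y - u \<bullet> lcomb v x = (\<Sum>j\<in>UNIV. (y j - x j) * (u \<bullet> v j))"
    by (simp add: inner_lcomb left_diff_distrib sum_subtractf)
  have nonneg: "0 \<le> (y j - x j) * (u \<bullet> v j)" for j
  proof -
    have "if s j = 0 then \<bar>y j\<bar> \<le> 1 else y j = s j"
      "if sface v u s j = 0 then \<bar>x j\<bar> \<le> 1 else x j = sface v u s j"
      by (rule closed_repD[OF assms(1)], rule closed_repD[OF assms(2)])
    then show ?thesis
      by (auto simp: sface_def sgn_if mult_nonpos_nonpos split: if_splits)
  qed
  then show "u \<bullet> lcomb v x \<le> u \<bullet> lcomb v y"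
    using diff by (smt (verit) sum_nonneg)
  assume "u \<bullet> lcomb v y = u \<bullet> lcomb v x"
  then have "(\<Sum>j\<in>UNIV. (y j - x j) * (u \<bullet> v j)) = 0"
    using diff by simp
  then have zero: "(y j - x j) * (u \<bullet> v j) = 0" for j
    using nonneg by (simp add: sum_nonneg_eq_0_iff del: mult_eq_0_iff)
  show "closed_rep (sface v u s) y"
    unfolding closed_rep_def
  proof
    fix j
    have "if s j = 0 then \<bar>y j\<bar> \<le> 1 else y j = s j"
      "if sface v u s j = 0 then \<bar>x j\<bar> \<le> 1 else x j = sface v u s j"
      by (rule closed_repD[OF assms(1)], rule closed_repD[OF assms(2)])
    then show "if sface v u s j = 0 then \<bar>y j\<bar> \<le> 1 else y j = sface v u s j"
      using zero[of j] by (auto simp: sface_def sgn_0_0 split: if_splits)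
  qed
qed

lemma eventually_abs_less:
  assumes "\<bar>x\<bar> < 1 \<or> (\<bar>x\<bar> \<le> 1 \<and> m * x < 0)"
  shows "\<forall>\<^sub>F t in at_right 0. \<bar>x + t * m\<bar> < (1::real)"
proof (cases "\<bar>x\<bar> < 1")
  case True
  have "((\<lambda>t. \<bar>x + t * m\<bar>) \<longlongrightarrow> \<bar>x + 0 * m\<bar>) (at_right 0)"
    by (intro tendsto_intros)
  then show ?thesis
    using True by (intro order_tendstoD(2)[of _ "\<bar>x\<bar>"]) auto
next
  case False
  with assms have x: "x = 1 \<and> m < 0 \<or> x = -1 \<and> 0 < m"
    by (auto simp: mult_less_0_iff)
  show ?thesis
  proof (rule eventually_at_rightI[of _ "1 / \<bar>m\<bar>"])
    show "0 < 1 / \<bar>m\<bar>"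
      using x by auto
    fix t assume "t \<in> {0<..<1 / \<bar>m\<bar>}"
    moreover have "0 < \<bar>m\<bar>"
      using x by auto
    ultimately have "0 < t * \<bar>m\<bar>" "t * \<bar>m\<bar> < 1"
      by (simp_all add: pos_less_divide_eq del: zero_less_abs_iff)
    then show "\<bar>x + t * m\<bar> < 1"
      using x by auto
  qed
qed

text \<open>By Motzkin's alternative, either some \<open>u\<close> fixes exactly those free
  coordinates of \<open>x\<close> that lie on the boundary of the cube, or a dependence pushes one
  of them strictly inwards and none outwards. The second case lowers the number of boundary
  coordinates without moving the point.\<close>

lemma ccell_point_in_face:
  fixes v :: "'n::finite \<Rightarrow> 'b::euclidean_space"
  assumes "\<And>j. s j \<in> {-1, 0, 1}" and "closed_rep s x"
  shows "\<exists>u. lcomb v x \<in> ocell v (sface v u s)"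
  using assms(2)
proof (induction "card {j. \<bar>x j\<bar> = 1}" arbitrary: x rule: less_induct)
  case less
  have x: "if s j = 0 then \<bar>x j\<bar> \<le> 1 else x j = s j" for j
    using less.prems by (rule closed_repD)
  define S where "S = {j. s j = 0}"
  \<comment> \<open>The face has to fix a boundary coordinate at its present value
    \<open>x j\<close>; as \<open>sface\<close> takes \<open>- sgn\<close>, the sign required of
    \<open>u \<bullet> v j\<close> is \<open>- x j\<close>.\<close>
  define r where "r j = (if \<bar>x j\<bar> < 1 then 0 else - x j)" for j
  have r: "r j \<in> {-1, 0, 1}" if "j \<in> S" for j
    using x[of j] that by (auto simp: S_def r_def)
  consider u where "\<forall>j\<in>S. sgn (u \<bullet> v j) = r j"
    | m k where "\<forall>j\<in>S. 0 \<le> m j * r j" "\<forall>j. j \<notin> S \<longrightarrow> m j = 0" "k \<in> S" "0 < m k * r k"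
      "(\<Sum>j\<in>UNIV. m j *\<^sub>R v j) = 0"
    using motzkin_sgn[of S r v] r by blast
  then show ?case
  proof cases
    case 1
    have "open_rep (sface v u s) x"
      unfolding open_rep_def
    proof
      fix j
      show "if sface v u s j = 0 then \<bar>x j\<bar> < 1 else x j = sface v u s j"
        using x[of j] 1 by (cases "j \<in> S") (auto simp: S_def sface_def r_def)
    qed
    then show ?thesis
      by (auto simp: ocell_def)
  next
    case 2
    have "\<forall>\<^sub>F t in at_right 0. \<forall>j\<in>S. (\<bar>x j\<bar> < 1 \<or> m j \<noteq> 0) \<longrightarrow> \<bar>x j + t * m j\<bar> < 1"
    proof (intro eventually_ball_finite ballI)
      fix j assume "j \<in> S"
      show "\<forall>\<^sub>F t in at_right 0. (\<bar>x j\<bar> < 1 \<or> m j \<noteq> 0) \<longrightarrow> \<bar>x j + t * m j\<bar> < 1"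
      proof (cases "\<bar>x j\<bar> < 1 \<or> m j \<noteq> 0")
        case True
        have "\<bar>x j\<bar> < 1 \<or> (\<bar>x j\<bar> \<le> 1 \<and> m j * x j < 0)"
        proof (cases "\<bar>x j\<bar> < 1")
          case False
          then have "m j * x j \<le> 0" "m j * x j \<noteq> 0"
            using 2(1) \<open>j \<in> S\<close> True by (auto simp: r_def)
          then show ?thesis
            using x[of j] \<open>j \<in> S\<close> by (auto simp: S_def)
        qed simp
        then show ?thesis
          using eventually_abs_less[of "x j" "m j"] by (auto elim: eventually_mono)
      qed simp
    qed simp
    then obtain t where t: "\<And>j. j \<in> S \<Longrightarrow> \<bar>x j\<bar> < 1 \<or> m j \<noteq> 0 \<Longrightarrow> \<bar>x j + t * m j\<bar> < 1"
      using eventually_happens'[OF trivial_limit_at_right_real] by blast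
    define y where "y j = x j + t * m j" for j
    have S: "y j = x j" if "j \<notin> S" for j
      using 2(2) that by (simp add: y_def)
    have le: "\<bar>y j\<bar> \<le> 1" if "j \<in> S" for j
      using x[of j] t[OF that] that by (cases "\<bar>x j\<bar> < 1 \<or> m j \<noteq> 0") (auto simp: S_def y_def)
    have "closed_rep s y"
      unfolding closed_rep_def
    proof
      fix j
      show "if s j = 0 then \<bar>y j\<bar> \<le> 1 else y j = s j"
        using S[of j] le[of j] x[of j] by (auto simp: S_def)
    qed
    moreover have "lcomb v y = lcomb v x"
      using 2(5) unfolding y_def lcomb_add lcomb_scale by (simp add: lcomb_def)
    moreover have "card {j. \<bar>y j\<bar> = 1} < card {j. \<bar>x j\<bar> = 1}"
    proof (intro psubset_card_mono psubsetI)
      show "{j. \<bar>y j\<bar> = 1} \<subseteq> {j. \<bar>x j\<bar> = 1}"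
      proof
        fix j assume "j \<in> {j. \<bar>y j\<bar> = 1}"
        then show "j \<in> {j. \<bar>x j\<bar> = 1}"
          using S[of j] t[of j] x[of j] by (cases "j \<in> S"; cases "\<bar>x j\<bar> < 1") (auto simp: y_def S_def)
      qed
      have "m k \<noteq> 0" "\<not> \<bar>x k\<bar> < 1"
        using 2(4) by (auto simp: r_def split: if_splits)
      then have "k \<in> {j. \<bar>x j\<bar> = 1}" "k \<notin> {j. \<bar>y j\<bar> = 1}"
        using x[of k] t[of k] 2(3) by (auto simp: S_def y_def)
      then show "{j. \<bar>y j\<bar> = 1} \<noteq> {j. \<bar>x j\<bar> = 1}"
        by blast
    qed simp
    ultimately show ?thesis
      using less.hyps[of y] by simp
  qed
qed

section \<open>Tiles met by a line in direction \<open>v i\<close>\<close>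

context
  fixes v :: "'n::finite \<Rightarrow> 'b::euclidean_space" and T
  assumes T: "sign_tiling v T"
begin

lemma tiling_sign: "s \<in> T \<Longrightarrow> s j \<in> {-1, 0, 1}"
  using T unfolding sign_tiling_def by metis

lemma tiling_disjoint: "s \<in> T \<Longrightarrow> s' \<in> T \<Longrightarrow> z \<in> ocell v s \<Longrightarrow> z \<in> ocell v s' \<Longrightarrow> s = s'"
  using T unfolding sign_tiling_def by metis

lemma tiling_face: "s \<in> T \<Longrightarrow> sface v u s \<in> T"
  using T unfolding sign_tiling_def by metis

lemma finite_tiling: "finite T"
proof (rule finite_subset)
  show "T \<subseteq> (\<Pi>\<^sub>E j\<in>UNIV. {-1, 0, 1})"
    using tiling_sign by auto
qed (simp add: finite_PiE)

lemma tiling_cover: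
  assumes "\<And>j. \<bar>x j\<bar> \<le> 1"
  obtains s where "s \<in> T" "lcomb v x \<in> ocell v s"
proof -
  have "\<exists>s\<in>T. lcomb v x \<in> ccell v s"
    using T assms by (simp add: sign_tiling_def)
  then obtain s y where s: "s \<in> T" "closed_rep s y" "lcomb v x = lcomb v y"
    unfolding ccell_def by blast
  obtain u where "lcomb v y \<in> ocell v (sface v u s)"
    using ccell_point_in_face[OF tiling_sign[OF s(1)] s(2)] by blast
  then show ?thesis
    using that[OF tiling_face[OF s(1)]] s(3) by simp
qed

text \<open>The face of \<open>s\<close> whose open cell contains \<open>z\<close> must be
  \<open>k\<close>, since open cells are disjoint. This is the face-to-face property in the form
  used below.\<close>

lemma tiling_cell_is_face:
  assumes "s \<in> T" "k \<in> T" "z \<in> ccell v s" "z \<in> ocell v k"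
  obtains u where "k = sface v u s"
proof -
  obtain x where x: "closed_rep s x" "z = lcomb v x"
    using assms(3) by (auto simp: ccell_def)
  obtain u where "lcomb v x \<in> ocell v (sface v u s)"
    using ccell_point_in_face[OF tiling_sign[OF assms(1)] x(1)] by blast
  then show ?thesis
    using tiling_disjoint[OF assms(2) tiling_face[OF assms(1)] assms(4)] x(2) that by simp
qed

lemma tiling_face_rep:
  assumes "k \<in> T" "k = sface v u s" "closed_rep s x" "lcomb v x \<in> ocell v k"
  shows "closed_rep k x"
proof -
  obtain y where y: "open_rep k y" "lcomb v x = lcomb v y"
    using assms(4) by (auto simp: ocell_def)
  show ?thesis
    using sface_minimal(2)[OF assms(3) open_imp_closed_rep[OF y(1), unfolded assms(2)]] y(2) assms(2)
    by simp
qed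

lemma tiling_cover_segment:
  assumes "s \<in> T" "s' \<in> T" "p \<in> ccell v s" "p + c *\<^sub>R w \<in> ccell v s'" "t \<in> {0..c}"
  obtains k where "k \<in> T" "p + t *\<^sub>R w \<in> ocell v k"
proof (cases "c = 0")
  case False
  then have "0 < c"
    using assms(5) by auto
  obtain x y where xy: "closed_rep s x" "p = lcomb v x" "closed_rep s' y" "p + c *\<^sub>R w = lcomb v y"
    using assms(3,4) by (auto simp: ccell_def)
  define z where "z j = (1 - t / c) * x j + (t / c) * y j" for j
  have ab: "0 \<le> t / c" "0 \<le> 1 - t / c"
    using assms(5) \<open>0 < c\<close> by auto
  have "\<bar>x j\<bar> \<le> 1" "\<bar>y j\<bar> \<le> 1" for j
    by (rule closed_rep_cube[OF xy(1) tiling_sign[OF assms(1)]], rule closed_rep_cube[OF xy(3) tiling_sign[OF assms(2)]])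
  then have "closed_rep (\<lambda>_. 0) x" "closed_rep (\<lambda>_. 0) y"
    by (auto simp: closed_rep_def)
  then have "closed_rep (\<lambda>_. 0) z"
    unfolding z_def using ab by (intro closed_rep_convex) auto
  then have "\<bar>z j\<bar> \<le> 1" for j
    by (simp add: closed_rep_def)
  moreover have "lcomb v z = (1 - t / c) *\<^sub>R p + (t / c) *\<^sub>R (p + c *\<^sub>R w)"
    unfolding z_def lcomb_add lcomb_scale xy(2)[symmetric] xy(4)[symmetric] ..
  then have "lcomb v z = p + t *\<^sub>R w"
    using \<open>0 < c\<close> by (simp add: algebra_simps)
  ultimately show ?thesis
    using tiling_cover[of z] that by auto
next
  case True
  then have "t = 0"
    using assms(5) by auto
  obtain x where x: "closed_rep s x" "p = lcomb v x"
    using assms(3) by (auto simp: ccell_def)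
  have "\<bar>x j\<bar> \<le> 1" for j
    by (rule closed_rep_cube[OF x(1) tiling_sign[OF assms(1)]])
  then show ?thesis
    using tiling_cover[of x] that x(2) \<open>t = 0\<close> by auto
qed

lemma closed_line_ccell: "closed {t. p + t *\<^sub>R w \<in> ccell v s}"
  using continuous_closed_vimage[of "ccell v s" "\<lambda>t. p + t *\<^sub>R w"]
  by (simp add: vimage_def compact_ccell compact_imp_closed)

text \<open>
  At the last upper point \<open>q\<close> of the line, every non-upper tile through \<open>q\<close> has \<open>q\<close> on a face
  that is maximal in direction \<open>v i\<close>, so no tile through \<open>q\<close> can contain the points just beyond \<open>q\<close>.
\<close>

lemma upper_stays_upper:
  assumes "s \<in> T" "k \<in> T" "p \<in> ocell v s" "p + c *\<^sub>R v i \<in> ocell v k" "0 < c" "s i = 1"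
  shows "k i = 1"
proof (rule ccontr)
  assume "k i \<noteq> 1"
  define D where "D = {0..c} \<inter> (\<Union>r\<in>{r\<in>T. r i = 1}. {t. p + t *\<^sub>R v i \<in> ccell v r})"
  have "compact D"
    unfolding D_def using finite_tiling
    by (intro compact_Int_closed closed_UN) (auto simp: closed_line_ccell)
  moreover have "0 \<in> D"
    using assms ocell_subset_ccell by (auto simp: D_def)
  ultimately obtain m where m: "m \<in> D" "\<And>t. t \<in> D \<Longrightarrow> t \<le> m"
    using compact_attains_sup[of D] by blast
  define q where "q = p + m *\<^sub>R v i"
  obtain r where r: "r \<in> T" "r i = 1" "q \<in> ccell v r" "0 \<le> m" "m \<le> c"
    using m(1) by (auto simp: D_def q_def)
  note cover = tiling_cover_segment[OF assms(1,2) subsetD[OF ocell_subset_ccell assms(3)]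
      subsetD[OF ocell_subset_ccell assms(4)]]
  obtain h where h: "h \<in> T" "q \<in> ocell v h"
    using cover[of m] r by (auto simp: q_def)
  obtain u where "h = sface v u r"
    using tiling_cell_is_face[OF r(1) h(1) r(3) h(2)] .
  then have "h i = 1"
    using r(2) by (simp add: sface_def)
  then have "m \<noteq> c"
    using tiling_disjoint[OF assms(2) h(1)] assms(4) h(2) \<open>k i \<noteq> 1\<close> by (auto simp: q_def)
  then have "m < c"
    using r(5) by simp
  have leave: "p + t *\<^sub>R v i \<notin> ccell v r'" if r': "r' \<in> T" "q \<in> ccell v r'" "m < t" "t \<le> c" for r' t
  proof
    assume t: "p + t *\<^sub>R v i \<in> ccell v r'"
    show False
    proof (cases "r' i = 1")
      case True
      then have "t \<in> D"
        using t that r(4) by (auto simp: D_def)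
      then show False
        using m(2) that(3) by force
    next
      case False
      obtain u where u: "h = sface v u r'"
        using tiling_cell_is_face[OF r'(1) h(1) r'(2) h(2)] .
      then have neg: "u \<bullet> v i < 0"
        using \<open>h i = 1\<close> False by (auto simp: sface_def sgn_if split: if_splits)
      obtain x where x: "closed_rep h x" "q = lcomb v x"
        using h(2) ocell_subset_ccell by (force simp: ccell_def)
      obtain y where y: "closed_rep r' y" "p + t *\<^sub>R v i = lcomb v y"
        using t by (auto simp: ccell_def)
      have "u \<bullet> q \<le> u \<bullet> (p + t *\<^sub>R v i)"
        using sface_minimal(1)[OF y(1)] x y u by metis
      then have "m * (u \<bullet> v i) \<le> t * (u \<bullet> v i)"
        by (simp add: q_def inner_add_right)
      then show False
        using neg that(3) by (simp add: mult_le_cancel_right)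
    qed
  qed
  \<comment> \<open>The finitely many tiles that miss \<open>q\<close> are closed, so near the
    parameter \<open>m\<close> the line meets only tiles through \<open>q\<close>.\<close>
  define W where "W = (\<Union>r\<in>{r\<in>T. q \<notin> ccell v r}. {t. p + t *\<^sub>R v i \<in> ccell v r})"
  have "closed W"
    unfolding W_def using finite_tiling by (intro closed_UN) (auto simp: closed_line_ccell)
  moreover have "m \<notin> W"
    by (auto simp: W_def q_def)
  ultimately obtain e where e: "0 < e" "\<And>t. dist t m < e \<Longrightarrow> t \<notin> W"
    using open_dist[of "- W"] by (auto simp: open_Compl)
  define t where "t = min c (m + e / 2)"
  have t: "m < t" "t \<le> c" "dist t m < e"
    using e(1) \<open>m < c\<close> by (auto simp: t_def dist_real_def)
  obtain r' where r': "r' \<in> T" "p + t *\<^sub>R v i \<in> ocell v r'"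
    using cover[of t] t r(4) by auto
  then have "p + t *\<^sub>R v i \<in> ccell v r'"
    using ocell_subset_ccell by blast
  then show False
    using leave[OF r'(1) _ t(1,2)] e(2)[OF t(3)] r'(1) by (auto simp: W_def)
qed

text \<open>Let \<open>q\<close> be the last point of the segment in \<open>s\<close>, in the open
  cell of the face \<open>h = sface v u s\<close>. If \<open>u\<close> is constant along the line,
  then \<open>h = s\<close> and the line could run on inside \<open>s\<close>, so \<open>q\<close>
  is the end point. If \<open>u\<close> decreases, \<open>h\<close> has sign 1 at \<open>i\<close>,
  and this sign persists. If \<open>u\<close> increases, \<open>q\<close> is the starting point and
  \<open>h = s\<close>, although \<open>h\<close> has sign -1 at \<open>i\<close>.\<close>

lemma zone_stays_or_upper:
  assumes "s \<in> T" "k \<in> T" "p \<in> ocell v s" "p + c *\<^sub>R v i \<in> ocell v k" "0 < c" "s i = 0"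
  shows "k = s \<or> k i = 1"
proof -
  define D where "D = {0..c} \<inter> {t. p + t *\<^sub>R v i \<in> ccell v s}"
  have "compact D"
    unfolding D_def by (intro compact_Int_closed) (auto simp: closed_line_ccell)
  moreover have "0 \<in> D"
    using assms ocell_subset_ccell by (auto simp: D_def)
  ultimately obtain m where m: "m \<in> D" "\<And>t. t \<in> D \<Longrightarrow> t \<le> m"
    using compact_attains_sup[of D] by blast
  define q where "q = p + m *\<^sub>R v i"
  have q: "q \<in> ccell v s" "0 \<le> m" "m \<le> c"
    using m(1) by (auto simp: D_def q_def)
  obtain h where h: "h \<in> T" "q \<in> ocell v h"
    using tiling_cover_segment[OF assms(1,2) subsetD[OF ocell_subset_ccell assms(3)]
      subsetD[OF ocell_subset_ccell assms(4)], of m] q by (auto simp: q_def)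
  obtain u where u: "h = sface v u s"
    using tiling_cell_is_face[OF assms(1) h(1) q(1) h(2)] .
  have end_eq: "k = h" if "m = c"
    using tiling_disjoint[OF assms(2) h(1)] assms(4) h(2) that by (auto simp: q_def)
  obtain x where x: "open_rep s x" "p = lcomb v x"
    using assms(3) by (auto simp: ocell_def)
  obtain y where y: "open_rep h y" "q = lcomb v y"
    using h(2) by (auto simp: ocell_def)
  note min = sface_minimal[OF open_imp_closed_rep[OF x(1)] open_imp_closed_rep[OF y(1), unfolded u]]
  have uq: "u \<bullet> q = u \<bullet> p + m * (u \<bullet> v i)"
    by (simp add: q_def inner_add_right)
  have le: "m * (u \<bullet> v i) \<le> 0"
    using min(1) uq x(2) y(2) by simp
  consider "u \<bullet> v i = 0" | "u \<bullet> v i < 0" | "0 < u \<bullet> v i"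
    by linarith
  then show ?thesis
  proof cases
    case 1
    then have "closed_rep h x"
      using min(2) uq x(2) y(2) u by simp
    have "h = s"
    proof
      fix j
      have "if s j = 0 then \<bar>x j\<bar> < 1 else x j = s j" "if h j = 0 then \<bar>x j\<bar> \<le> 1 else x j = h j"
        by (rule open_repD[OF x(1)], rule closed_repD[OF \<open>closed_rep h x\<close>])
      then show "h j = s j"
        using tiling_sign[OF h(1), of j] u by (auto simp: sface_def split: if_splits)
    qed
    have "m = c"
    proof (rule ccontr)
      assume "m \<noteq> c"
      then have "m < c"
        using q(3) by simp
      have "\<bar>y i\<bar> < 1"
        using y(1) \<open>h = s\<close> assms(6) by (simp add: open_rep_def)
      define e where "e = min (c - m) ((1 - y i) / 2)"
      have e: "0 < e" "m + e \<le> c" "\<bar>y i + e\<bar> < 1"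
        using \<open>\<bar>y i\<bar> < 1\<close> \<open>m < c\<close> unfolding e_def by (auto simp: min_def abs_less_iff field_simps)
      have "open_rep s (y(i := y i + e))"
        using open_rep_shift[of s y i "y i + e"] y(1) \<open>h = s\<close> assms(6) e(3) by simp
      moreover have "lcomb v (y(i := y i + e)) = p + (m + e) *\<^sub>R v i"
        using y(2) by (simp add: lcomb_upd q_def scaleR_add_left flip: y(2))
      ultimately have "p + (m + e) *\<^sub>R v i \<in> ccell v s"
        using open_imp_closed_rep unfolding ccell_def by (metis image_eqI mem_Collect_eq)
      then have "m + e \<in> D"
        using e q(2) by (simp add: D_def)
      then show False
        using m(2) e(1) by force
    qed
    then show ?thesis
      using end_eq \<open>h = s\<close> by simp
  next
    case 2
    then have "h i = 1"
      using u assms(6) by (simp add: sface_def)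
    show ?thesis
    proof (cases "m = c")
      case False
      have "k i = 1"
        using upper_stays_upper[OF h(1) assms(2) h(2), of "c - m" i] assms(4) False q(3) \<open>h i = 1\<close>
        by (simp add: q_def algebra_simps)
      then show ?thesis ..
    qed (use end_eq \<open>h i = 1\<close> in simp)
  next
    case 3
    then have "m = 0"
      using le q(2) by (simp add: mult_le_0_iff)
    then have "h = s"
      using tiling_disjoint[OF h(1) assms(1) h(2)] assms(3) by (simp add: q_def)
    moreover have "h i = -1"
      using 3 u assms(6) by (simp add: sface_def)
    ultimately show ?thesis
      using assms(6) by simp
  qed
qed

text \<open>Otherwise the parameters in tiles of sign -1 and those in tiles of sign 1 form two
  closed sets covering the segment. At a common point the tile with that point in its open cell
  would be a face of both kinds and inherit both signs; so the sets are disjoint, against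
  connectedness.\<close>

lemma zone_between:
  assumes "s \<in> T" "k \<in> T" "p \<in> ocell v s" "p + c *\<^sub>R v i \<in> ocell v k" "0 < c" "s i = -1" "k i = 1"
  obtains t w where "w \<in> T" "w i = 0" "p + t *\<^sub>R v i \<in> ocell v w"
proof (rule ccontr)
  assume "\<not> thesis"
  then have nz: "w i \<noteq> 0" if "w \<in> T" "p + t *\<^sub>R v i \<in> ocell v w" for w t
    using that \<open>\<And>w t. w \<in> T \<Longrightarrow> w i = 0 \<Longrightarrow> p + t *\<^sub>R v i \<in> ocell v w \<Longrightarrow> thesis\<close> by blast
  define U where "U c' = (\<Union>r\<in>{r\<in>T. r i = c'}. {t. p + t *\<^sub>R v i \<in> ccell v r})" for c'
  have closed: "closed (U c')" for c'
    unfolding U_def using finite_tiling by (intro closed_UN) (auto simp: closed_line_ccell)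
  note cover = tiling_cover_segment[OF assms(1,2) subsetD[OF ocell_subset_ccell assms(3)]
      subsetD[OF ocell_subset_ccell assms(4)]]
  have "{0..c} \<subseteq> U (-1) \<union> U 1"
  proof
    fix t assume "t \<in> {0..c}"
    then obtain r where r: "r \<in> T" "p + t *\<^sub>R v i \<in> ocell v r"
      using cover by blast
    then have "r i = -1 \<or> r i = 1" "p + t *\<^sub>R v i \<in> ccell v r"
      using nz tiling_sign[of r i] ocell_subset_ccell by blast+
    then show "t \<in> U (-1) \<union> U 1"
      using r(1) by (auto simp: U_def)
  qed
  moreover have "U (-1) \<inter> U 1 \<inter> {0..c} = {}"
  proof (rule ccontr)
    assume "U (-1) \<inter> U 1 \<inter> {0..c} \<noteq> {}"
    then obtain t where "t \<in> {0..c}" "t \<in> U (-1)" "t \<in> U 1"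
      by blast
    then obtain r r' where t: "t \<in> {0..c}" "r \<in> T" "r i = -1" "p + t *\<^sub>R v i \<in> ccell v r"
      "r' \<in> T" "r' i = 1" "p + t *\<^sub>R v i \<in> ccell v r'"
      unfolding U_def by blast
    obtain h where h: "h \<in> T" "p + t *\<^sub>R v i \<in> ocell v h"
      using cover t(1) by blast
    obtain u where "h = sface v u r"
      using tiling_cell_is_face[OF t(2) h(1) t(4) h(2)] .
    then have "h i = -1"
      using t(3) by (simp add: sface_def)
    obtain u' where "h = sface v u' r'"
      using tiling_cell_is_face[OF t(5) h(1) t(7) h(2)] .
    then have "h i = 1"
      using t(6) by (simp add: sface_def)
    with \<open>h i = -1\<close> show False
      by simp
  qed
  moreover have "0 \<in> U (-1)" "c \<in> U 1"
    using assms ocell_subset_ccell by (auto simp: U_def)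
  ultimately show False
    using connected_closedD[OF connected_Icc[of 0 c], of "U (-1)" "U 1"] closed assms(5)
    by (simp add: disjoint_iff) (metis atLeastAtMost_iff less_imp_le order_refl)
qed

end

section \<open>Deletion of an element\<close>

context
  fixes v :: "'n::finite \<Rightarrow> 'b::euclidean_space" and T
  assumes T: "sign_tiling v T"
begin

lemma ocell_delete:
  assumes "z \<in> ocell (v(i := 0)) (s(i := 0))"
  obtains x where "\<And>c. (if s i = 0 then \<bar>c\<bar> < 1 else c = s i) \<Longrightarrow> open_rep s (x(i := c))"
    and "\<And>c. lcomb v (x(i := c)) = z + c *\<^sub>R v i"
proof -
  obtain x where x: "open_rep (s(i := 0)) x" "z = lcomb (v(i := 0)) x"
    using assms by (auto simp: ocell_def)
  show ?thesis
  proof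
    fix c assume c: "if s i = 0 then \<bar>c\<bar> < 1 else c = s i"
    show "open_rep s (x(i := c))"
      unfolding open_rep_def
    proof
      fix j
      show "if s j = 0 then \<bar>(x(i := c)) j\<bar> < 1 else (x(i := c)) j = s j"
        using c open_repD[OF x(1), of j] by (cases "j = i") (simp_all split: if_splits)
    qed
  next
    fix c show "lcomb v (x(i := c)) = z + c *\<^sub>R v i"
      by (simp add: x(2) lcomb_vec_upd lcomb_upd algebra_simps)
  qed
qed

lemma ocell_undelete:
  assumes "z \<in> ocell (v(i := 0)) (s(i := 0))" and "if s i = 0 then \<bar>c\<bar> < 1 else c = s i"
  shows "z + c *\<^sub>R v i \<in> ocell v s"
  using ocell_delete[OF assms(1)] assms(2) unfolding ocell_def by (metis image_eqI mem_Collect_eq)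

text \<open>The open cell of \<open>w\<close> contains all points \<open>z + c *\<^sub>R v i\<close>
  with \<open>\<bar>c\<bar> < 1\<close>. If \<open>k i = 0\<close>, an open cell point of
  \<open>k\<close> is among them. Otherwise \<open>z + k i *\<^sub>R v i\<close> is an end point, so
  \<open>k\<close> is a face of \<open>w\<close>; the remaining free coordinates are strictly inside
  the cube there, so \<open>k\<close> fixes only \<open>i\<close> in addition.\<close>

lemma delete_zone_unique:
  assumes "w \<in> T" "w i = 0" "k \<in> T"
    and z: "z \<in> ocell (v(i := 0)) (w(i := 0))" "z \<in> ocell (v(i := 0)) (k(i := 0))"
  shows "w(i := 0) = k(i := 0)"
proof -
  obtain x where x: "\<And>c. \<bar>c\<bar> < 1 \<Longrightarrow> open_rep w (x(i := c))" "\<And>c. lcomb v (x(i := c)) = z + c *\<^sub>R v i"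
    using ocell_delete[OF z(1)] assms(2) by (metis (no_types, lifting))
  have k: "z + k i *\<^sub>R v i \<in> ocell v k"
    using ocell_undelete[OF z(2), of "k i"] by simp
  show ?thesis
  proof (cases "k i = 0")
    case True
    then have "z + k i *\<^sub>R v i \<in> ocell v w"
      using ocell_undelete[OF z(1), of 0] assms(2) by simp
    then show ?thesis
      using tiling_disjoint[OF T assms(1,3) _ k] by simp
  next
    case False
    have cl: "closed_rep w (x(i := k i))"
      unfolding closed_rep_def
    proof
      fix j
      show "if w j = 0 then \<bar>(x(i := k i)) j\<bar> \<le> 1 else (x(i := k i)) j = w j"
        using open_repD[OF x(1)[of 0], of j] tiling_sign[OF T assms(3), of i] assms(2)
        by (cases "j = i") (auto split: if_splits)
    qed
    then have zw: "z + k i *\<^sub>R v i \<in> ccell v w"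
      using x(2)[of "k i"] unfolding ccell_def by (metis image_eqI mem_Collect_eq)
    obtain u where u: "k = sface v u w"
      using tiling_cell_is_face[OF T assms(1,3) zw k] .
    have clk: "closed_rep k (x(i := k i))"
      using tiling_face_rep[OF T assms(3) u cl] k x(2)[of "k i"] by simp
    show ?thesis
    proof
      fix j
      show "(w(i := 0)) j = (k(i := 0)) j"
      proof (cases "j = i \<or> w j \<noteq> 0")
        case True
        then show ?thesis
          using u by (auto simp: sface_def)
      next
        case False
        then have "\<bar>x j\<bar> < 1"
          using open_repD[OF x(1)[of 0], of j] by simp
        then have "k j = 0"
          using closed_repD[OF clk, of j] tiling_sign[OF T assms(3), of j] False by (auto split: if_splits)
        then show ?thesis
          using False by simp
      qed
    qed
  qed
qed

text \<open>The line from \<open>z - v i\<close> to \<open>z + v i\<close> passes from sign -1 to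
  sign 1 and so meets a tile \<open>w\<close> with \<open>i\<close> free, which contains an open
  segment of parameter length 2. Monotonicity of the sign keeps this segment between the two points,
  so it is centred at \<open>z\<close>, and \<open>w\<close> collapses to the same tile as
  \<open>s\<close> and as \<open>k\<close>.\<close>

lemma delete_opposite_unique:
  assumes "s \<in> T" "k \<in> T" "s i = -1" "k i = 1"
    and z: "z \<in> ocell (v(i := 0)) (s(i := 0))" "z \<in> ocell (v(i := 0)) (k(i := 0))"
  shows "s(i := 0) = k(i := 0)"
proof -
  have s: "z + (-1) *\<^sub>R v i \<in> ocell v s"
    using ocell_undelete[OF z(1), of "-1"] assms(3) by simp
  have k: "z + 1 *\<^sub>R v i \<in> ocell v k"
    using ocell_undelete[OF z(2), of 1] assms(4) by simp
  obtain t w where w: "w \<in> T" "w i = 0" "z + (-1) *\<^sub>R v i + t *\<^sub>R v i \<in> ocell v w"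
  proof -
    have "z + 1 *\<^sub>R v i = z + (-1) *\<^sub>R v i + 2 *\<^sub>R v i"
      by (simp add: scaleR_2)
    then have "z + (-1) *\<^sub>R v i + 2 *\<^sub>R v i \<in> ocell v k"
      using k by metis
    then show thesis
      by (rule zone_between[OF T assms(1,2) s]) (use assms(3,4) that in auto)
  qed
  then obtain y where y: "open_rep w y" "z + (-1) *\<^sub>R v i + t *\<^sub>R v i = lcomb v y"
    by (auto simp: ocell_def)
  \<comment> \<open>The centre of the segment: at parameter \<open>t - 1\<close> from
    \<open>z\<close> the \<open>i\<close>-th coordinate is \<open>y i\<close>, so it is 0 at
    \<open>t - 1 - y i\<close>.\<close>
  define m where "m = t - 1 - y i"
  have line: "z + (m + q) *\<^sub>R v i \<in> ocell v w" if "\<bar>q\<bar> < 1" for q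
  proof -
    have "open_rep w (y(i := q))"
      by (rule open_rep_shift[OF y(1) w(2) that])
    moreover have "lcomb v (y(i := q)) = z + (m + q) *\<^sub>R v i"
      unfolding lcomb_upd y(2)[symmetric] m_def by (simp add: algebra_simps)
    ultimately show ?thesis
      unfolding ocell_def by (metis image_eqI mem_Collect_eq)
  qed
  have "m = 0"
  proof (rule ccontr)
    assume "m \<noteq> 0"
    then consider "0 < m" | "m < 0"
      by linarith
    then show False
    proof cases
      case 1
      \<comment> \<open>This offset from the centre stays inside the segment because
        \<open>m\<close> is positive, and reaches \<open>z + v i\<close> or a point beyond
        it.\<close>
      define q where "q = max 0 (1 - m)"
      have q: "\<bar>q\<bar> < 1" "1 \<le> m + q"
        using 1 by (auto simp: q_def)
      show False
      proof (cases "m + q = 1")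
        case True
        then show False
          using tiling_disjoint[OF T assms(2) w(1) k] line[OF q(1)] w(2) assms(4) by auto
      next
        case False
        have "z + (m + q) *\<^sub>R v i = z + 1 *\<^sub>R v i + (m + q - 1) *\<^sub>R v i"
          by (simp add: algebra_simps)
        then have "z + 1 *\<^sub>R v i + (m + q - 1) *\<^sub>R v i \<in> ocell v w"
          using line[OF q(1)] by metis
        then have "w i = 1"
          by (rule upper_stays_upper[OF T assms(2) w(1) k]) (use q(2) False assms(4) in auto)
        then show False
          using w(2) by simp
      qed
    next
      case 2
      define q where "q = min 0 (- 1 - m)"
      have q: "\<bar>q\<bar> < 1" "m + q \<le> - 1"
        using 2 by (auto simp: q_def)
      show False
      proof (cases "m + q = -1")
        case True
        then show False
          using tiling_disjoint[OF T assms(1) w(1) s] line[OF q(1)] w(2) assms(3) by auto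
      next
        case False
        have "z + (-1) *\<^sub>R v i = z + (m + q) *\<^sub>R v i + (- 1 - (m + q)) *\<^sub>R v i"
          by (simp add: algebra_simps)
        then have "z + (m + q) *\<^sub>R v i + (- 1 - (m + q)) *\<^sub>R v i \<in> ocell v s"
          using s by metis
        then have "s = w \<or> s i = 1"
          by (rule zone_stays_or_upper[OF T w(1) assms(1) line[OF q(1)]]) (use q(2) False w(2) in auto)
        then show False
          using w(2) assms(3) by auto
      qed
    qed
  qed
  have "z \<in> ocell (v(i := 0)) (w(i := 0))"
  proof -
    have "open_rep (w(i := 0)) (y(i := 0))"
      using open_repD[OF y(1)] unfolding open_rep_def by simp
    moreover have "lcomb (v(i := 0)) (y(i := 0)) = z"
      unfolding lcomb_vec_upd fun_upd_upd lcomb_upd y(2)[symmetric]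
      using \<open>m = 0\<close> by (simp add: m_def algebra_simps)
    ultimately show ?thesis
      unfolding ocell_def by (metis image_eqI mem_Collect_eq)
  qed
  then show ?thesis
    using delete_zone_unique[OF w(1,2) assms(1)] delete_zone_unique[OF w(1,2) assms(2)] z by metis
qed

text \<open>For the covering, look at \<open>z - v i\<close> and \<open>z + v i\<close>. A tile of
  sign -1 through the first or of sign 1 through the second covers \<open>z\<close> after the
  collapse. Otherwise monotonicity puts both points into one tile with \<open>i\<close> free, and
  convexity of that tile gives \<open>z\<close>.\<close>

lemma sign_tiling_delete: "sign_tiling (v(i := 0)) ((\<lambda>s. s(i := 0)) ` T)"
  unfolding sign_tiling_def
proof (intro conjI ballI allI impI)
  fix s j assume "s \<in> (\<lambda>s. s(i := 0)) ` T"
  then obtain s' where "s' \<in> T" "s = s'(i := 0)"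
    by blast
  then show "s j \<in> {-1, 0, 1}"
    using tiling_sign[OF T, of s' j] by simp
next
  fix s u assume "s \<in> (\<lambda>s. s(i := 0)) ` T"
  then obtain s' where s': "s' \<in> T" "s = s'(i := 0)"
    by blast
  have "sface (v(i := 0)) u s = (sface v u s')(i := 0)"
    by (auto simp: sface_def s'(2))
  then show "sface (v(i := 0)) u s \<in> (\<lambda>s. s(i := 0)) ` T"
    using tiling_face[OF T s'(1)] by blast
next
  fix x :: "'n \<Rightarrow> real" assume x: "\<forall>j. \<bar>x j\<bar> \<le> 1"
  define z where "z = lcomb (v(i := 0)) x"
  have z: "lcomb v (x(i := c)) = z + c *\<^sub>R v i" for c
    by (simp add: z_def lcomb_vec_upd lcomb_upd algebra_simps)
  have "\<bar>(x(i := -1)) j\<bar> \<le> 1" "\<bar>(x(i := 1)) j\<bar> \<le> 1" for j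
    using x by simp_all
  then obtain s k where s: "s \<in> T" "z + (-1) *\<^sub>R v i \<in> ocell v s" and k: "k \<in> T" "z + 1 *\<^sub>R v i \<in> ocell v k"
    using tiling_cover[OF T] z by metis
  obtain y where y: "closed_rep s y" "z + (-1) *\<^sub>R v i = lcomb v y"
    using s(2) open_imp_closed_rep by (auto simp: ocell_def)
  obtain y' where y': "closed_rep k y'" "z + 1 *\<^sub>R v i = lcomb v y'"
    using k(2) open_imp_closed_rep by (auto simp: ocell_def)
  have del: "lcomb (v(i := 0)) y = z + (-1 - y i) *\<^sub>R v i" "lcomb (v(i := 0)) y' = z + (1 - y' i) *\<^sub>R v i"
    unfolding lcomb_vec_upd lcomb_upd y(2)[symmetric] y'(2)[symmetric] by (simp_all add: algebra_simps)
  have cl: "closed_rep (h(i := 0)) r" if "closed_rep h r" "h \<in> T" for h r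
    unfolding closed_rep_def
  proof
    fix j show "if (h(i := 0)) j = 0 then \<bar>r j\<bar> \<le> 1 else r j = (h(i := 0)) j"
      using closed_repD[OF that(1), of j] closed_rep_cube[OF that(1) tiling_sign[OF T that(2)], of j] by simp
  qed
  have "\<exists>h\<in>T. \<exists>r. closed_rep (h(i := 0)) r \<and> lcomb (v(i := 0)) r = z"
  proof (cases "s i = -1 \<or> k i = 1")
    case True
    then show ?thesis
    proof
      assume "s i = -1"
      then have "y i = -1"
        using closed_repD[OF y(1), of i] by simp
      then show ?thesis
        using del(1) cl[OF y(1) s(1)] s(1) by auto
    next
      assume "k i = 1"
      then have "y' i = 1"
        using closed_repD[OF y'(1), of i] by simp
      then show ?thesis
        using del(2) cl[OF y'(1) k(1)] k(1) by auto
    qed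
  next
    case False
    have k2: "z + (-1) *\<^sub>R v i + 2 *\<^sub>R v i \<in> ocell v k"
      using k(2) by (simp add: algebra_simps scaleR_2)
    have "s i \<noteq> 1"
      using upper_stays_upper[OF T s(1) k(1) s(2) k2] False by auto
    then have "s i = 0"
      using False tiling_sign[OF T s(1), of i] by auto
    then have "k = s"
      using zone_stays_or_upper[OF T s(1) k(1) s(2) k2] False by auto
    define a where "a = 1 + y i"
    define b where "b = 1 - y' i"
    have ab: "0 \<le> a" "0 \<le> b"
      using closed_rep_cube[OF y(1) tiling_sign[OF T s(1)], of i]
        closed_rep_cube[OF y'(1) tiling_sign[OF T k(1)], of i] by (auto simp: a_def b_def)
    show ?thesis
    proof (cases "a + b = 0")
      case True
      then have "y i = -1"
        using ab by (simp add: a_def)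
      then show ?thesis
        using del(1) cl[OF y(1) s(1)] s(1) by auto
    next
      case False
      \<comment> \<open>The weights cancel the drifts \<open>- a\<close> and \<open>b\<close> along
        \<open>v i\<close> that the two representations acquire when their \<open>i\<close>-th
        coordinate is dropped.\<close>
      define r where "r j = b / (a + b) * y j + a / (a + b) * y' j" for j
      have frac: "b / (a + b) + a / (a + b) = 1"
        using False by (simp add: add_divide_distrib[symmetric] add.commute)
      have "closed_rep s r"
        unfolding r_def using y(1) y'(1) \<open>k = s\<close> ab frac by (intro closed_rep_convex) auto
      have "lcomb (v(i := 0)) r = (b / (a + b)) *\<^sub>R (z + (- a) *\<^sub>R v i) + (a / (a + b)) *\<^sub>R (z + b *\<^sub>R v i)"
        unfolding r_def lcomb_add lcomb_scale del by (simp add: a_def b_def)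
      also have "\<dots> = (b / (a + b) + a / (a + b)) *\<^sub>R z"
        by (simp add: algebra_simps)
      finally have "lcomb (v(i := 0)) r = z"
        using frac by simp
      then show ?thesis
        using cl[OF \<open>closed_rep s r\<close> s(1)] s(1) by blast
    qed
  qed
  then show "\<exists>s\<in>(\<lambda>s. s(i := 0)) ` T. lcomb (v(i := 0)) x \<in> ccell (v(i := 0)) s"
    unfolding z_def[symmetric] ccell_def by blast
next
  fix s k z
  assume "s \<in> (\<lambda>s. s(i := 0)) ` T" "k \<in> (\<lambda>s. s(i := 0)) ` T"
    and z: "z \<in> ocell (v(i := 0)) s" "z \<in> ocell (v(i := 0)) k"
  then obtain s' k' where s': "s' \<in> T" "s = s'(i := 0)" and k': "k' \<in> T" "k = k'(i := 0)"
    by blast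
  note z = z[unfolded s'(2) k'(2)]
  consider "s' i = 0" | "k' i = 0" | "s' i = -1" "k' i = 1" | "k' i = -1" "s' i = 1" | "s' i \<noteq> 0" "s' i = k' i"
    using tiling_sign[OF T s'(1), of i] tiling_sign[OF T k'(1), of i] by auto
  then show "s = k"
  proof cases
    case 1
    then show ?thesis
      using delete_zone_unique[OF s'(1) _ k'(1) z] s' k' by simp
  next
    case 2
    then show ?thesis
      using delete_zone_unique[OF k'(1) _ s'(1) z(2,1)] s' k' by simp
  next
    case 3
    then show ?thesis
      using delete_opposite_unique[OF s'(1) k'(1) _ _ z] s' k' by simp
  next
    case 4
    then show ?thesis
      using delete_opposite_unique[OF k'(1) s'(1) _ _ z(2,1)] s' k' by simp
  next
    case 5
    have "z + s' i *\<^sub>R v i \<in> ocell v s'"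
      using ocell_undelete[OF z(1), of "s' i"] 5 by simp
    moreover have "z + s' i *\<^sub>R v i \<in> ocell v k'"
      using ocell_undelete[OF z(2), of "s' i"] 5 by simp
    ultimately have "s' = k'"
      by (rule tiling_disjoint[OF T s'(1) k'(1)])
    then show ?thesis
      using s'(2) k'(2) by simp
  qed
qed

end

section \<open>Tiles and dependences\<close>

lemma sign_tiling_delete_set:
  fixes v :: "'n::finite \<Rightarrow> 'b::euclidean_space"
  assumes "sign_tiling v T"
  shows "sign_tiling (\<lambda>j. if j \<in> D then 0 else v j) ((\<lambda>s j. if j \<in> D then 0 else s j) ` T)"
  using finite[of D]
proof (induction D rule: finite_induct)
  case empty
  then show ?case
    using assms by simp
next
  case (insert i D)
  have v: "(\<lambda>j. if j \<in> insert i D then 0 else v j) = (\<lambda>j. if j \<in> D then 0 else v j)(i := 0)"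
    by (simp add: fun_eq_iff)
  have s: "(\<lambda>j. if j \<in> insert i D then 0 else s j) = (\<lambda>j. if j \<in> D then 0 else s j)(i := 0)"
    for s :: "'n \<Rightarrow> real"
    by (simp add: fun_eq_iff)
  show ?case
    using sign_tiling_delete[OF insert.IH, of i] unfolding v s image_image .
qed

text \<open>
  Adding \<open>2 / \<bar>l i\<bar>\<close> times the dependence to the vertex \<open>- sgn l\<close> of the tile \<open>t\<close> shows that this
  vertex also lies in the tile \<open>r\<close>, so the common face has sign \<open>sgn (l i)\<close> at \<open>i\<close>,
  which the vertex violates.
\<close>

lemma sign_tiling_no_tilt:
  fixes v :: "'n::finite \<Rightarrow> 'b::euclidean_space"
  assumes T: "sign_tiling v T" and "r \<in> T" "t \<in> T"
    and dep: "(\<Sum>j\<in>UNIV. l j *\<^sub>R v j) = 0"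
    and r: "\<And>j. j \<noteq> i \<Longrightarrow> r j = 0" "r i = sgn (l i)"
    and l: "l i \<noteq> 0" "\<And>j. \<bar>l j\<bar> \<le> \<bar>l i\<bar>"
    and t: "\<And>j. l j * t j \<le> 0" "\<And>j. l j = 0 \<Longrightarrow> t j = 0"
  shows False
proof -
  define x where "x j = - sgn (l j)" for j
  define y where "y j = - sgn (l j) + 2 / \<bar>l i\<bar> * l j" for j
  have "lcomb v y = lcomb v x"
    unfolding y_def x_def lcomb_add lcomb_scale by (simp add: lcomb_def dep)
  have x: "closed_rep t x"
    unfolding closed_rep_def
  proof
    fix j
    show "if t j = 0 then \<bar>x j\<bar> \<le> 1 else x j = t j"
      using t[of j] tiling_sign[OF T assms(3), of j]
      by (auto simp: x_def sgn_if mult_le_0_iff)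
  qed
  have y: "closed_rep r y"
    unfolding closed_rep_def
  proof
    fix j
    show "if r j = 0 then \<bar>y j\<bar> \<le> 1 else y j = r j"
    proof (cases "j = i")
      case True
      then show ?thesis
        using r(2) l(1) by (auto simp: y_def sgn_if)
    next
      case False
      \<comment> \<open>By maximality of \<open>\<bar>l i\<bar>\<close> the coordinate moves from
        \<open>- sgn (l j)\<close> towards \<open>sgn (l j)\<close> by at most 2, so it stays in the
        cube; at \<open>i\<close> it moves by exactly 2.\<close>
      have "\<bar>l j\<bar> / \<bar>l i\<bar> \<le> 1"
        using l by (simp add: divide_le_eq)
      then have "\<bar>y j\<bar> \<le> 1"
        unfolding y_def by (cases "0 < l j"; cases "l j = 0") (auto simp: sgn_if abs_le_iff)
      then show ?thesis
        using r(1)[OF False] by simp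
    qed
  qed
  have "\<bar>x j\<bar> \<le> 1" for j
    by (simp add: x_def sgn_if)
  then obtain k where k: "k \<in> T" "lcomb v x \<in> ocell v k"
    using tiling_cover[OF T] by blast
  have cells: "lcomb v x \<in> ccell v r" "lcomb v x \<in> ccell v t"
    using x y \<open>lcomb v y = lcomb v x\<close> unfolding ccell_def by (metis image_eqI mem_Collect_eq)+
  obtain u where u: "k = sface v u r"
    using tiling_cell_is_face[OF T assms(2) k(1) cells(1) k(2)] .
  then have ki: "k i = sgn (l i)"
    using r(2) l(1) by (simp add: sface_def sgn_0_0)
  obtain u' where u': "k = sface v u' t"
    using tiling_cell_is_face[OF T assms(3) k(1) cells(2) k(2)] .
  have "closed_rep k x"
    using tiling_face_rep[OF T k(1) u' x k(2)] .
  then have "- sgn (l i) = sgn (l i)"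
    using closed_repD[of k x i] ki l(1) by (simp add: x_def sgn_0_0)
  then show False
    using l(1) by (simp add: sgn_if split: if_splits)
qed

text \<open>A face of the whole zonotope has signs \<open>- sgn (u \<bullet> v j)\<close>, and the
  values \<open>u \<bullet> v j\<close> are orthogonal to every dependence. By the sign hypothesis
  all terms of this vanishing sum have the same sign, so each of them is 0.\<close>

lemma sign_tiling_zero_cell:
  fixes v :: "'n::finite \<Rightarrow> 'b::euclidean_space"
  assumes T: "sign_tiling v T" and "(\<lambda>_. 0) \<in> T" "s \<in> T"
    and dep: "(\<Sum>j\<in>UNIV. l j *\<^sub>R v j) = 0" and s: "\<And>j. 0 \<le> l j * s j" and "l j \<noteq> 0"
  shows "s j = 0"
proof -
  have y: "open_rep s s"
    by (simp add: open_rep_def)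
  have "closed_rep (\<lambda>_. 0) s"
    unfolding closed_rep_def
  proof
    fix j show "if (0::real) = 0 then \<bar>s j\<bar> \<le> 1 else s j = 0"
      using tiling_sign[OF T assms(3), of j] by auto
  qed
  then have "lcomb v s \<in> ccell v (\<lambda>_. 0)" "lcomb v s \<in> ocell v s"
    using y by (auto simp: ccell_def ocell_def)
  then obtain u where u: "s = sface v u (\<lambda>_. 0)"
    using tiling_cell_is_face[OF T assms(2,3)] by blast
  then have su: "s j = - sgn (u \<bullet> v j)" for j
    by (simp add: sface_def)
  have "0 = u \<bullet> (\<Sum>j\<in>UNIV. l j *\<^sub>R v j)"
    by (simp add: dep)
  also have "\<dots> = (\<Sum>j\<in>UNIV. l j * (u \<bullet> v j))"
    by (simp add: inner_sum_right)
  finally have "(\<Sum>j\<in>UNIV. - (l j * (u \<bullet> v j))) = 0"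
    by (simp add: sum_negf)
  moreover have "0 \<le> - (l j * (u \<bullet> v j))" for j
    using s[of j] unfolding su by (auto simp: sgn_if mult_le_0_iff zero_le_mult_iff split: if_splits)
  ultimately have "- (l j * (u \<bullet> v j)) = 0"
    by (simp add: sum_nonneg_eq_0_iff del: neg_equal_0_iff_equal mult_eq_0_iff)
  then show ?thesis
    using \<open>l j \<noteq> 0\<close> su by simp
qed

lemma sign_tiling_orthogonal:
  fixes v :: "'n::finite \<Rightarrow> 'b::euclidean_space"
  assumes T: "sign_tiling v T" and "s \<in> T" "t \<in> T"
    and dep: "(\<Sum>j\<in>UNIV. l j *\<^sub>R v j) = 0"
    and min: "\<And>m. (\<Sum>j\<in>UNIV. m j *\<^sub>R v j) = 0 \<Longrightarrow> {j. m j \<noteq> 0} \<subset> {j. l j \<noteq> 0} \<Longrightarrow> m = (\<lambda>_. 0)"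
    and s: "\<And>j. 0 \<le> l j * s j" and t: "\<And>j. l j * t j \<le> 0" and "l k \<noteq> 0"
  shows "s k = 0 \<and> t k = 0"
proof -
  obtain i where i: "\<And>j. \<bar>l j\<bar> \<le> \<bar>l i\<bar>"
  proof -
    have "Max (range (\<lambda>j. \<bar>l j\<bar>)) \<in> range (\<lambda>j. \<bar>l j\<bar>)"
      by (intro Max_in) auto
    then obtain i where "Max (range (\<lambda>j. \<bar>l j\<bar>)) = \<bar>l i\<bar>"
      by blast
    then show thesis
      using that[of i] Max_ge[of "range (\<lambda>j. \<bar>l j\<bar>)"] by (metis finite finite_imageI rangeI)
  qed
  have li: "l i \<noteq> 0"
    using i[of k] \<open>l k \<noteq> 0\<close> by auto
  obtain r where r: "r \<in> T" "\<And>j. l j \<noteq> 0 \<Longrightarrow> j \<noteq> i \<Longrightarrow> r j = 0"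
  proof -
    \<comment> \<open>By minimality the circuit vectors other than \<open>v i\<close> are linearly
      independent, so every representation of the centre of the collapsed zonotope is zero at their
      labels. The tile with the centre in its open cell can therefore fix none of these
      labels.\<close>
    define D where "D = insert i {j. l j = 0}"
    define vD where "vD j = (if j \<in> D then 0 else v j)" for j
    have T': "sign_tiling vD ((\<lambda>s j. if j \<in> D then 0 else s j) ` T)"
      unfolding vD_def using sign_tiling_delete_set[OF T] .
    obtain r' where r': "r' \<in> (\<lambda>s j. if j \<in> D then 0 else s j) ` T" "lcomb vD (\<lambda>_. 0) \<in> ocell vD r'"
      using tiling_cover[OF T', of "\<lambda>_. 0"] by auto
    then obtain r where r: "r \<in> T" "r' = (\<lambda>j. if j \<in> D then 0 else r j)"
      by blast
    obtain x where x: "open_rep r' x" "lcomb vD x = 0"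
      using r'(2) by (auto simp: ocell_def lcomb_def)
    define m where "m j = (if j \<in> D then 0 else x j)" for j
    have "(\<Sum>j\<in>UNIV. m j *\<^sub>R v j) = lcomb vD x"
      unfolding lcomb_def by (rule sum.cong) (auto simp: m_def vD_def)
    moreover have "{j. m j \<noteq> 0} \<subset> {j. l j \<noteq> 0}"
    proof
      show "{j. m j \<noteq> 0} \<subseteq> {j. l j \<noteq> 0}"
        by (auto simp: m_def D_def)
      show "{j. m j \<noteq> 0} \<noteq> {j. l j \<noteq> 0}"
        using li by (auto simp: m_def D_def)
    qed
    ultimately have m: "m = (\<lambda>_. 0)"
      using min x(2) by simp
    have "r j = 0" if "l j \<noteq> 0" "j \<noteq> i" for j
    proof -
      have "j \<notin> D"
        using that by (simp add: D_def)
      then have "x j = 0" "r' j = r j"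
        using fun_cong[OF m, of j] r(2) by (simp_all add: m_def)
      then show ?thesis
        using open_repD[OF x(1), of j] by (simp split: if_splits)
    qed
    then show thesis
      using that r(1) by blast
  qed
  define E where "E = {j. l j = 0}"
  define vE where "vE j = (if j \<in> E then 0 else v j)" for j
  define res where "res f = (\<lambda>j. if j \<in> E then 0 else f j)" for f :: "'n \<Rightarrow> real"
  have TE: "sign_tiling vE (res ` T)"
    unfolding vE_def res_def using sign_tiling_delete_set[OF T] .
  have depE: "(\<Sum>j\<in>UNIV. l j *\<^sub>R vE j) = 0"
  proof -
    have "(\<Sum>j\<in>UNIV. l j *\<^sub>R vE j) = (\<Sum>j\<in>UNIV. l j *\<^sub>R v j)"
      by (rule sum.cong) (auto simp: vE_def E_def)
    then show ?thesis
      using dep by simp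
  qed
  then have depE': "(\<Sum>j\<in>UNIV. - l j *\<^sub>R vE j) = 0"
    by (simp add: sum_negf)
  have rE: "res r j = 0" if "j \<noteq> i" for j
    using r(2) that by (auto simp: res_def E_def)
  have ri: "res r i = r i"
    using li by (simp add: res_def E_def)
  have lres: "l j * res f j = l j * f j" "l j = 0 \<Longrightarrow> res f j = 0" for f j
    by (simp_all add: res_def E_def)
  have in_res: "res r \<in> res ` T" "res s \<in> res ` T" "res t \<in> res ` T"
    using r(1) assms(2,3) by blast+
  \<comment> \<open>The tile \<open>t\<close> excludes one sign; passing to \<open>- l\<close>
    exchanges the roles of \<open>s\<close> and \<open>t\<close> and excludes the other.\<close>
  have "r i \<noteq> sgn (l i)"
  proof
    assume "r i = sgn (l i)"
    then show False
      using sign_tiling_no_tilt[OF TE in_res(1,3) depE rE _ li i] ri t lres by simp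
  qed
  moreover have "r i \<noteq> - sgn (l i)"
  proof
    assume "r i = - sgn (l i)"
    then show False
      using sign_tiling_no_tilt[OF TE in_res(1,2) depE' rE, of i] ri li i s lres by (simp add: sgn_minus)
  qed
  ultimately have "r i = 0"
    using tiling_sign[OF T r(1), of i] li by (auto simp: sgn_if split: if_splits)
  then have "res r = (\<lambda>_. 0)"
    using rE ri by (intro ext) metis
  then have zero: "(\<lambda>_. 0) \<in> res ` T"
    using in_res(1) by simp
  have "res s k = 0"
    using sign_tiling_zero_cell[OF TE zero in_res(2) depE _ \<open>l k \<noteq> 0\<close>] s lres(1) by simp
  moreover have "res t k = 0"
    using sign_tiling_zero_cell[OF TE zero in_res(3) depE', of k] t \<open>l k \<noteq> 0\<close> lres(1) by simp
  ultimately show ?thesis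
    using \<open>l k \<noteq> 0\<close> by (simp add: res_def E_def)
qed

section \<open>From tilings to sign vectors\<close>

definition tile_sign :: "'n set \<Rightarrow> 'n set \<Rightarrow> 'n \<Rightarrow> real" where
  "tile_sign X Y = (\<lambda>j. if j \<in> X then 1 else if j \<in> Y then 0 else -1)"

text \<open>The affine map of zonotopes induced by the coordinate change from \<open>[-1,1]\<close>
  to \<open>[0,1]\<close>.\<close>

definition halve :: "('n::finite \<Rightarrow> 'b::euclidean_space) \<Rightarrow> 'b \<Rightarrow> 'b" where
  "halve v z = (1 / 2) *\<^sub>R (z + (\<Sum>j\<in>UNIV. v j))"

lemma inj_halve: "halve v z = halve v z' \<longleftrightarrow> z = z'"
  by (simp add: halve_def)

lemma halve_affine: "(1 - e) *\<^sub>R halve v z + e *\<^sub>R halve v z' = halve v (z' + (e - 1) *\<^sub>R (z' - z))"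
proof -
  have "(1 - e) *\<^sub>R (z + s) + e *\<^sub>R (z' + s) = z' + (e - 1) *\<^sub>R (z' - z) + s" for s
    by (simp add: algebra_simps)
  then show ?thesis
    by (simp only: halve_def scaleR_left_commute[of _ "1 / 2"] flip: scaleR_right_distrib)
qed

lemma zproj_eq_halve:
  "zproj a x = halve (\<lambda>j. (a j, 1)) (lcomb (\<lambda>j. (a j, 1)) (\<lambda>j. 2 * x $ j - 1))"
proof -
  have "lcomb (\<lambda>j. (a j, 1::real)) (\<lambda>j. 2 * x $ j - 1) + (\<Sum>j\<in>UNIV. (a j, 1)) = 2 *\<^sub>R zproj a x"
    unfolding lcomb_def zproj_def scaleR_sum_right sum.distrib[symmetric]
    by (rule sum.cong) (simp_all add: algebra_simps)
  then show ?thesis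
    by (simp add: halve_def)
qed

lemma tile_eq_halve_ccell:
  fixes a :: "'n::finite \<Rightarrow> 'a::euclidean_space"
  assumes "X \<subseteq> Y"
  shows "convex hull (zonotope_config a ` {X..Y}) =
    halve (\<lambda>j. (a j, 1)) ` ccell (\<lambda>j. (a j, 1)) (tile_sign X Y)"
proof -
  have "x \<in> cube_face X Y \<longleftrightarrow> closed_rep (tile_sign X Y) (\<lambda>j. 2 * x $ j - 1)" for x
  proof -
    have "x \<in> cube_face X Y \<longleftrightarrow>
        (\<forall>j. 0 \<le> x $ j \<and> x $ j \<le> 1 \<and> (j \<in> X \<longrightarrow> x $ j = 1) \<and> (j \<notin> Y \<longrightarrow> x $ j = 0))"
      by (auto simp: cube_face_def unit_cube_def)
    also have "\<dots> \<longleftrightarrow> closed_rep (tile_sign X Y) (\<lambda>j. 2 * x $ j - 1)"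
      unfolding closed_rep_def
      using assms by (intro arg_cong[of _ _ All] ext) (auto simp: tile_sign_def abs_le_iff)
    finally show ?thesis .
  qed
  then have eq: "cube_face X Y = {x. closed_rep (tile_sign X Y) (\<lambda>j. 2 * x $ j - 1)}"
    by blast
  have "{x. closed_rep (tile_sign X Y) x} = (\<lambda>x j. 2 * x $ j - 1) ` cube_face X Y"
  proof (intro set_eqI iffI)
    fix x assume x: "x \<in> {x. closed_rep (tile_sign X Y) x}"
    have "x = (\<lambda>j. 2 * (\<chi> j. (x j + 1) / 2) $ j - 1)"
      by (simp add: fun_eq_iff field_simps)
    moreover from this have "(\<chi> j. (x j + 1) / 2) \<in> cube_face X Y"
      using x unfolding eq by simp
    ultimately show "x \<in> (\<lambda>x j. 2 * x $ j - 1) ` cube_face X Y"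
      by blast
  qed (auto simp: eq)
  then show ?thesis
    unfolding ccell_def tile_eq_convex_hull[OF assms, symmetric]
    by (simp add: image_image zproj_eq_halve)
qed

text \<open>An open representation leaves room at every free coordinate, so a segment from any point
  of the tile to the given point can be prolonged a little inside the tile; this characterises
  relative interior points.\<close>

lemma halve_ocell_rel_interior:
  fixes a :: "'n::finite \<Rightarrow> 'a::euclidean_space"
  assumes "X \<subseteq> Y" and z: "z \<in> ocell (\<lambda>j. (a j, 1)) (tile_sign X Y)"
  shows "halve (\<lambda>j. (a j, 1)) z \<in> rel_interior (convex hull (zonotope_config a ` {X..Y}))"
proof -
  define v where "v j = (a j, 1::real)" for j
  define s where "s = tile_sign X Y"
  note hull = tile_eq_halve_ccell[OF assms(1), of a, folded v_def s_def]
  obtain x where x: "open_rep s x" "z = lcomb v x"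
    using z unfolding ocell_def v_def s_def by blast
  have "\<exists>e>1. (1 - e) *\<^sub>R y + e *\<^sub>R halve v z \<in> halve v ` ccell v s"
    if y: "y \<in> halve v ` ccell v s" for y
  proof -
    obtain x' where x': "closed_rep s x'" "y = halve v (lcomb v x')"
      using y by (auto simp: ccell_def)
    have "\<forall>\<^sub>F t in at_right 0. \<forall>j\<in>{j. s j = 0}. \<bar>x j + t * (x j - x' j)\<bar> < 1"
      using open_repD[OF x(1)]
      by (intro eventually_ball_finite ballI eventually_abs_less) auto
    moreover have "\<forall>\<^sub>F t in at_right 0. (0::real) < t"
      by (rule eventually_at_right_less)
    ultimately obtain t where t: "\<And>j. s j = 0 \<Longrightarrow> \<bar>x j + t * (x j - x' j)\<bar> < 1" "0 < t"
      using eventually_happens'[OF trivial_limit_at_right_real eventually_conj] by blast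
    have "closed_rep s (\<lambda>j. x j + t * (x j - x' j))"
      unfolding closed_rep_def
    proof
      fix j
      show "if s j = 0 then \<bar>x j + t * (x j - x' j)\<bar> \<le> 1 else x j + t * (x j - x' j) = s j"
        using t(1)[of j] open_repD[OF x(1), of j] closed_repD[OF x'(1), of j] by auto
    qed
    then have "lcomb v (\<lambda>j. x j + t * (x j - x' j)) \<in> ccell v s"
      unfolding ccell_def by (intro imageI CollectI)
    moreover have "lcomb v (\<lambda>j. x j + t * (x j - x' j)) = z + t *\<^sub>R (z - lcomb v x')"
      by (simp add: x(2) lcomb_def scaleR_add_left scaleR_diff_left sum.distrib sum_subtractf
          scaleR_sum_right scaleR_diff_right flip: scaleR_scaleR)
    ultimately have "z + t *\<^sub>R (z - lcomb v x') \<in> ccell v s"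
      by simp
    then have "halve v (z + t *\<^sub>R (z - lcomb v x')) \<in> halve v ` ccell v s"
      by (rule imageI)
    then show ?thesis
      using t(2) by (intro exI[of _ "1 + t"]) (simp add: x'(2) halve_affine[of "1 + t", simplified])
  qed
  moreover have "halve v ` ccell v s \<noteq> {}"
    using x(1) open_imp_closed_rep by (auto simp: ccell_def)
  ultimately show ?thesis
    unfolding v_def[symmetric] using convex_rel_interior_iff[OF convex_convex_hull] hull by metis
qed

lemma tile_label_face:
  fixes a :: "'n::finite \<Rightarrow> 'a::euclidean_space"
  shows "label_face (zonotope_config a)
    {X \<union> {j\<in>Y. u \<bullet> (a j, 1::real) < 0}..{j\<in>Y. j \<in> X \<or> u \<bullet> (a j, 1::real) \<le> 0}} {X..Y}"
proof -
  define d where "d j = u \<bullet> (a j, 1::real)" for j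
  define N where "N = X \<union> {j\<in>Y. d j < 0}"
  define F where "F = {N..{j\<in>Y. j \<in> X \<or> d j \<le> 0}}"
  have d: "u \<bullet> zonotope_config a I = sum d I" for I
    by (simp add: zonotope_config_eq inner_sum_right d_def)
  have "F = {I \<in> {X..Y}. sum d I = sum d N}"
  proof -
    have "F \<subseteq> {X..Y}"
      unfolding F_def N_def by auto
    then show ?thesis
      using interval_minimizers(2)[of _ X Y d] unfolding F_def N_def by blast
  qed
  then have "label_face (zonotope_config a) F {X..Y}"
    unfolding label_face_def using interval_minimizers(1)[of _ X Y d]
    by (intro exI[of _ u] exI[of _ "sum d N"]) (auto simp: d N_def)
  then show ?thesis
    unfolding F_def N_def d_def .
qed

lemma zonotopal_tiling_sign_tiling:
  fixes a :: "'n::finite \<Rightarrow> 'a::euclidean_space"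
  assumes "zonotopal_tiling a T"
  shows "sign_tiling (\<lambda>j. (a j, 1::real)) {tile_sign X Y | X Y. X \<subseteq> Y \<and> {X..Y} \<in> T}"
    (is "sign_tiling ?v ?S")
  unfolding sign_tiling_def
proof (intro conjI ballI allI impI)
  have poly: "polyhedral_subdivision (zonotope_config a) T"
    and tiles: "\<And>C. C \<in> T \<Longrightarrow> C \<noteq> {} \<Longrightarrow> \<exists>X Y. X \<subseteq> Y \<and> C = {X..Y}"
    using assms unfolding zonotopal_tiling_def by simp_all
  from poly have faces: "\<And>C F. C \<in> T \<Longrightarrow> label_face (zonotope_config a) F C \<Longrightarrow> F \<in> T"
    and cover: "(\<Union>C\<in>T. convex hull (zonotope_config a ` C)) = convex hull (range (zonotope_config a))"
    and disj: "\<And>C C'. C \<in> T \<Longrightarrow> C' \<in> T \<Longrightarrow> C \<noteq> C' \<Longrightarrow>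
      rel_interior (convex hull (zonotope_config a ` C)) \<inter>
      rel_interior (convex hull (zonotope_config a ` C')) = {}"
    unfolding polyhedral_subdivision_def by metis+
  show "s j \<in> {-1, 0, 1}" if s: "s \<in> ?S" for s j
  proof -
    obtain X Y where "s = tile_sign X Y"
      using s by blast
    then show ?thesis
      by (simp add: tile_sign_def)
  qed
  show "\<exists>s\<in>?S. lcomb ?v x \<in> ccell ?v s" if x: "\<forall>j. \<bar>x j\<bar> \<le> 1" for x
  proof -
    have "closed_rep (tile_sign {} UNIV) x"
      using x by (simp add: closed_rep_def tile_sign_def)
    then have "halve ?v (lcomb ?v x) \<in> convex hull (zonotope_config a ` {{}..UNIV})"
      unfolding tile_eq_halve_ccell[OF empty_subsetI] ccell_def by blast
    moreover have "{{}..UNIV :: 'n set} = UNIV"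
      by auto
    ultimately obtain C where C: "C \<in> T" "halve ?v (lcomb ?v x) \<in> convex hull (zonotope_config a ` C)"
      using cover by auto
    then have "C \<noteq> {}"
      by auto
    then obtain X Y where XY: "X \<subseteq> Y" "C = {X..Y}"
      using tiles[OF C(1)] by blast
    then have "halve ?v (lcomb ?v x) \<in> halve ?v ` ccell ?v (tile_sign X Y)"
      using C(2) tile_eq_halve_ccell[OF XY(1), of a] by simp
    then have "lcomb ?v x \<in> ccell ?v (tile_sign X Y)"
      by (auto simp: inj_halve)
    then show ?thesis
      using C(1) XY by blast
  qed
  show "s = s'" if s: "s \<in> ?S" "s' \<in> ?S" and z: "z \<in> ocell ?v s" "z \<in> ocell ?v s'" for s s' z
  proof -
    obtain X Y where X: "X \<subseteq> Y" "{X..Y} \<in> T" "s = tile_sign X Y"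
      using s by blast
    obtain X' Y' where X': "X' \<subseteq> Y'" "{X'..Y'} \<in> T" "s' = tile_sign X' Y'"
      using s by blast
    have "{X..Y} = {X'..Y'}"
      using disj[OF X(2) X'(2)] halve_ocell_rel_interior[OF X(1) z(1)[unfolded X(3)]]
        halve_ocell_rel_interior[OF X'(1) z(2)[unfolded X'(3)]] by blast
    then show ?thesis
      using X X' by (simp add: Icc_eq_Icc)
  qed
  show "sface ?v u s \<in> ?S" if s: "s \<in> ?S" for s u
  proof -
    obtain X Y where X: "X \<subseteq> Y" "{X..Y} \<in> T" "s = tile_sign X Y"
      using s by blast
    define X' where "X' = X \<union> {j\<in>Y. u \<bullet> (a j, 1::real) < 0}"
    define Y' where "Y' = {j\<in>Y. j \<in> X \<or> u \<bullet> (a j, 1::real) \<le> 0}"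
    have "{X'..Y'} \<in> T"
      unfolding X'_def Y'_def by (rule faces[OF X(2) tile_label_face])
    moreover have "X' \<subseteq> Y'"
      using X(1) by (auto simp: X'_def Y'_def)
    moreover have "sface ?v u s = tile_sign X' Y'"
      unfolding sface_def X(3) tile_sign_def X'_def Y'_def using X(1) by (intro ext) (auto simp: sgn_if)
    ultimately show ?thesis
      by blast
  qed
qed

lemma zonotopal_tiling_imp_separated:
  fixes a :: "'n::finite \<Rightarrow> 'a::euclidean_space"
  assumes T: "zonotopal_tiling a T" and "X1 \<subseteq> Y1" "X2 \<subseteq> Y2" "{X1..Y1} \<in> T" "{X2..Y2} \<in> T"
  shows "separated a X1 Y1 X2 Y2"
  unfolding separated_def
proof (rule notI, elim exE conjE)
  fix Cp Cm
  assume circ: "circuit a Cp Cm" and sub: "Cp \<subseteq> Y1 - X2" "Cm \<subseteq> Y2 - X1"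
    and nsub: "\<not> Cp \<union> Cm \<subseteq> Y1 \<inter> Y2 - (X1 \<union> X2)"
  then obtain c where c: "affine_dependence a c" "Cp = {i. 0 < c i}" "Cm = {i. c i < 0}"
    unfolding circuit_def by blast
  have supp: "Cp \<union> Cm = {i. c i \<noteq> 0}"
    by (auto simp: c)
  have dep: "(\<Sum>j\<in>UNIV. m j *\<^sub>R (a j, 1::real)) = 0 \<longleftrightarrow> affine_dependence a m" for m
    by (simp add: affine_dependence_def prod_eq_iff fst_sum snd_sum)
  obtain k where k: "k \<in> Cp \<union> Cm" "k \<notin> Y1 \<inter> Y2 - (X1 \<union> X2)"
    using nsub by blast
  have "tile_sign X1 Y1 k = 0 \<and> tile_sign X2 Y2 k = 0"
  proof (rule sign_tiling_orthogonal[OF zonotopal_tiling_sign_tiling[OF T]])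
    show "tile_sign X1 Y1 \<in> {tile_sign X Y | X Y. X \<subseteq> Y \<and> {X..Y} \<in> T}"
      "tile_sign X2 Y2 \<in> {tile_sign X Y | X Y. X \<subseteq> Y \<and> {X..Y} \<in> T}"
      using assms by blast+
    show "(\<Sum>j\<in>UNIV. c j *\<^sub>R (a j, 1::real)) = 0"
      using dep c(1) by blast
    show "m = (\<lambda>_. 0)" if m: "(\<Sum>j\<in>UNIV. m j *\<^sub>R (a j, 1::real)) = 0" "{j. m j \<noteq> 0} \<subset> {j. c j \<noteq> 0}" for m
    proof -
      have "\<not> affinely_dependent_labels a {j. m j \<noteq> 0}"
        using circ m(2) unfolding circuit_def supp by blast
      then show ?thesis
        using m(1) unfolding dep affinely_dependent_labels_def by blast
    qed
    \<comment> \<open>The inclusion \<open>Cp \<subseteq> Y1\<close> excludes the sign -1 where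
      \<open>c j\<close> is positive, and \<open>Cm\<close> avoiding \<open>X1\<close> excludes the
      sign 1 where it is negative. For the second tile the signs are exchanged.\<close>
    show "0 \<le> c j * tile_sign X1 Y1 j" for j
      using sub unfolding c by (cases "0 < c j"; cases "c j < 0") (auto simp: tile_sign_def)
    show "c j * tile_sign X2 Y2 j \<le> 0" for j
      using sub unfolding c by (cases "0 < c j"; cases "c j < 0") (auto simp: tile_sign_def)
    show "c k \<noteq> 0"
      using k(1) supp by blast
  qed
  then show False
    using k(2) by (auto simp: tile_sign_def split: if_splits)
qed

theorem theorem4p6:
  fixes a :: "'n::finite \<Rightarrow> 'a::euclidean_space" and V :: "'a set"
    and X1 Y1 X2 Y2 :: "'n set"
  assumes "subspace V" and "affine hull (range a) = V"
    and "X1 \<subseteq> Y1" and "X2 \<subseteq> Y2"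
  shows
    "(separated a X1 Y1 X2 Y2 \<longleftrightarrow>
        (\<exists>T. zonotopal_tiling a T \<and> {X1..Y1} \<in> T \<and> {X2..Y2} \<in> T)) \<and>
     (separated a X1 Y1 X2 Y2 \<longleftrightarrow>
        (\<exists>T. coherent_zonotopal_tiling a T \<and> {X1..Y1} \<in> T \<and> {X2..Y2} \<in> T)) \<and>
     (separated a X1 Y1 X2 Y2 \<longleftrightarrow>
        (\<exists>S. polyhedral_subdivision a S \<and> Y1 - X2 \<in> S \<and> Y2 - X1 \<in> S)) \<and>
     (separated a X1 Y1 X2 Y2 \<longleftrightarrow>
        (\<exists>S. coherent_subdivision a S \<and> Y1 - X2 \<in> S \<and> Y2 - X1 \<in> S))"
proof -
  let ?sep = "separated a X1 Y1 X2 Y2"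
  have "\<exists>T. coherent_zonotopal_tiling a T \<and> {X1..Y1} \<in> T \<and> {X2..Y2} \<in> T" if ?sep
    using separated_imp_coherent_tiling[OF that assms(3,4)] .
  moreover have "?sep" if "zonotopal_tiling a T" "{X1..Y1} \<in> T" "{X2..Y2} \<in> T" for T
    using zonotopal_tiling_imp_separated[OF that(1) assms(3,4) that(2,3)] .
  moreover have "zonotopal_tiling a T" if "coherent_zonotopal_tiling a T" for T
    using that by (simp add: coherent_zonotopal_tiling_def)
  moreover have "\<exists>S. coherent_subdivision a S \<and> Y1 - X2 \<in> S \<and> Y2 - X1 \<in> S" if ?sep
    using separated_imp_coherent_subdivision[OF that] .
  moreover have "?sep" if "polyhedral_subdivision a S" "Y1 - X2 \<in> S" "Y2 - X1 \<in> S" for S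
    using polyhedral_subdivision_imp_separated[OF that] .
  moreover have "polyhedral_subdivision a S" if "coherent_subdivision a S" for S
    using that by (simp add: coherent_subdivision_def)
  ultimately show ?thesis
    by meson
qed

end
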